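(* Let $D$ be a domain in $\mathbb R^n$, $n\ge2$, and let $\Phi:[1,\infty]\to[0,\infty]$ be a nonconstant function with $\Phi(\infty)=\infty$. If $\Phi$ is either not convex, or not nondecreasing, or not continuous from the left at the point $T=\sup\{t:\Phi(t)<\infty\}$, then there exists a sequence of homeomorphisms $f_j$ of $D$ into $\mathbb R^n$ of class $W^{1,1}_{\rm loc}(D)$ converging locally uniformly to a mapping $f:D\to\mathbb R^n$ that is differentiable a.e., such that for every open bounded set $\Omega\subseteq D$ and every continuous function $\Psi:\mathbb R^n\to(0,\infty)$ $$\int_\Omega\Phi(P_f(x))\,\Psi(x)\,dm(x)>\limsup_{j\to\infty}\int_\Omega\Phi(P_{f_j}(x))\,\Psi(x)\,dm(x).$$ In particular this holds for $\Psi\equiv1$ and for $\Psi(x)=(1+|x|^2)^{-n}$.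
   Context: Continuity is in the topology of $[0,\infty]$. For $x\in D$ with all first partials, $\|f'(x)\|=\sup_{|h|=1}|f'(x)h|$, $J_f(x)=\det f'(x)$; the outer dilatation is $K_f(x)=\|f'(x)\|^n/|J_f(x)|$ if $J_f(x)\ne0$, $K_f(x)=1$ if $f'(x)=0$, and $K_f(x)=\infty$ otherwise (including points without first partial derivatives). $P_f(x)=K_f(x)^{1/(n-1)}$. *)

theory Defs
  imports "HOL-Analysis.Analysis"
begin

definition has_partial :: "(real^'n \<Rightarrow> 'b::real_normed_vector) \<Rightarrow> 'n \<Rightarrow> real^'n \<Rightarrow> bool" where
  "has_partial f i x \<longleftrightarrow> (\<lambda>h::real. f (x + h *\<^sub>R axis i 1)) differentiable (at 0)"

definition partial_at :: "(real^'n \<Rightarrow> 'b::real_normed_vector) \<Rightarrow> 'n \<Rightarrow> real^'n \<Rightarrow> 'b" where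
  "partial_at f i x = vector_derivative (\<lambda>h::real. f (x + h *\<^sub>R axis i 1)) (at 0)"

definition has_all_partials :: "(real^'n \<Rightarrow> 'b::real_normed_vector) \<Rightarrow> real^'n \<Rightarrow> bool" where
  "has_all_partials f x \<longleftrightarrow> (\<forall>i. has_partial f i x)"

definition jac :: "(real^'n \<Rightarrow> real^'n) \<Rightarrow> real^'n \<Rightarrow> real^'n^'n" where
  "jac f x = (\<chi> j i. partial_at f i x $ j)"

definition outer_dilatation :: "(real^'n \<Rightarrow> real^'n) \<Rightarrow> real^'n \<Rightarrow> ennreal" where
  "outer_dilatation f x =
     (if has_all_partials f x then
        (if det (jac f x) \<noteq> 0
         then ennreal (onorm (\<lambda>h. jac f x *v h) ^ CARD('n) / \<bar>det (jac f x)\<bar>)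
         else if jac f x = 0 then 1 else top)
      else top)"

definition P_dil :: "(real^'n \<Rightarrow> real^'n) \<Rightarrow> real^'n \<Rightarrow> ennreal" where
  "P_dil f x = (if outer_dilatation f x = top then top
                else ennreal (enn2real (outer_dilatation f x) powr (1 / (real CARD('n) - 1))))"

fun Ck :: "nat \<Rightarrow> (real^'n \<Rightarrow> real) \<Rightarrow> bool" where
  "Ck 0 g \<longleftrightarrow> continuous_on UNIV g"
| "Ck (Suc k) g \<longleftrightarrow> continuous_on UNIV g \<and> (\<forall>x. has_all_partials g x) \<and> (\<forall>i. Ck k (partial_at g i))"

definition smooth_fun :: "(real^'n \<Rightarrow> real) \<Rightarrow> bool" where
  "smooth_fun g \<longleftrightarrow> (\<forall>k. Ck k g)"

definition test_function :: "(real^'n) set \<Rightarrow> (real^'n \<Rightarrow> real) \<Rightarrow> bool" where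
  "test_function D \<phi> \<longleftrightarrow> smooth_fun \<phi> \<and> compact (closure {x. \<phi> x \<noteq> 0}) \<and> closure {x. \<phi> x \<noteq> 0} \<subseteq> D"

definition loc_integrable :: "(real^'n) set \<Rightarrow> (real^'n \<Rightarrow> real^'m) \<Rightarrow> bool" where
  "loc_integrable D f \<longleftrightarrow> (\<forall>K. compact K \<and> K \<subseteq> D \<longrightarrow> f absolutely_integrable_on K)"

definition W11_loc :: "(real^'n) set \<Rightarrow> (real^'n \<Rightarrow> real^'m) \<Rightarrow> bool" where
  "W11_loc D f \<longleftrightarrow> loc_integrable D f \<and>
     (\<exists>g :: 'n \<Rightarrow> real^'n \<Rightarrow> real^'m. (\<forall>i. loc_integrable D (g i)) \<and>
        (\<forall>i \<phi>. test_function D \<phi> \<longrightarrow>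
           integral UNIV (\<lambda>x. partial_at \<phi> i x *\<^sub>R f x) = - integral UNIV (\<lambda>x. \<phi> x *\<^sub>R g i x)))"

definition Phi_convex :: "(ennreal \<Rightarrow> ennreal) \<Rightarrow> bool" where
  "Phi_convex \<Phi> \<longleftrightarrow> (\<forall>s t l::real. 1 \<le> s \<longrightarrow> 1 \<le> t \<longrightarrow> 0 \<le> l \<longrightarrow> l \<le> 1 \<longrightarrow>
      \<Phi> (ennreal (l * s + (1 - l) * t)) \<le> ennreal l * \<Phi> (ennreal s) + ennreal (1 - l) * \<Phi> (ennreal t))"

definition Phi_nondecreasing :: "(ennreal \<Rightarrow> ennreal) \<Rightarrow> bool" where
  "Phi_nondecreasing \<Phi> \<longleftrightarrow> (\<forall>s t. 1 \<le> s \<longrightarrow> s \<le> t \<longrightarrow> \<Phi> s \<le> \<Phi> t)"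

definition Phi_T :: "(ennreal \<Rightarrow> ennreal) \<Rightarrow> ennreal" where
  "Phi_T \<Phi> = Sup {t. 1 \<le> t \<and> \<Phi> t < top}"

definition Phi_left_cont_at_T :: "(ennreal \<Rightarrow> ennreal) \<Rightarrow> bool" where
  "Phi_left_cont_at_T \<Phi> \<longleftrightarrow> (\<Phi> \<longlongrightarrow> \<Phi> (Phi_T \<Phi>)) (at (Phi_T \<Phi>) within {1..<Phi_T \<Phi>})"

definition Phi_integral :: "(ennreal \<Rightarrow> ennreal) \<Rightarrow> (real^'n \<Rightarrow> real) \<Rightarrow> (real^'n) set \<Rightarrow> (real^'n \<Rightarrow> real^'n) \<Rightarrow> ennreal" where
  "Phi_integral \<Phi> \<Psi> \<Omega> f = (\<integral>\<^sup>+ x. indicator \<Omega> x * \<Phi> (P_dil f x) * ennreal (\<Psi> x) \<partial>lebesgue)"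

end

theory Submission
  imports Defs
begin

text \<open>All maps change a single coordinate \<open>x\<^sub>k\<close> into \<open>g (x\<^sub>k)\<close>. Where \<open>g' = c\<close>, the
  derivative is diagonal with one entry \<open>c\<close> and all others \<open>1\<close>, so \<open>P\<close> equals \<open>c\<close> for
  \<open>c \<ge> 1\<close>, \<open>(1 / c)\<close> to the power \<open>1 / (n - 1)\<close> for \<open>0 < c < 1\<close>, and \<open>\<infinity>\<close> for \<open>c = 0\<close>. A rapidly
  oscillating piecewise linear \<open>g\<close> with slopes \<open>a\<close> and \<open>b\<close> in proportions \<open>l\<close> and \<open>1 - l\<close>
  converges uniformly to the linear map of slope \<open>l a + (1 - l) b\<close>, while the integrals of \<open>\<Phi>\<close>
  converge to the corresponding average of its two values. If convexity fails at \<open>s, t\<close>, take these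
  as slopes. If \<open>\<Phi> s > \<Phi> t\<close> with \<open>s < t\<close>, take the slopes \<open>t\<close> and \<open>1 / t\<close> to the power
  \<open>n - 1\<close>, both of which have \<open>P = t\<close>, with mean \<open>s\<close>. If \<open>\<Phi>\<close> is nondecreasing but jumps at
  \<open>T\<close>, linear maps suffice, with slopes increasing to \<open>T\<close> or, when \<open>T = \<infinity>\<close>, decreasing to
  \<open>0\<close>.\<close>

section \<open>Stretching one coordinate\<close>

definition stretch :: "'n \<Rightarrow> (real \<Rightarrow> real) \<Rightarrow> real^'n \<Rightarrow> real^'n" where
  "stretch k g x = (\<chi> i. if i = k then g (x $ k) else x $ i)"

lemma stretch_eq: "stretch k g x = x + (g (x $ k) - x $ k) *\<^sub>R axis k 1"
  by (simp add: stretch_def vec_eq_iff axis_def)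

lemma partial_stretch:
  assumes "(g has_real_derivative c) (at (x $ k))"
  shows "((\<lambda>h. stretch k g (x + h *\<^sub>R axis i 1)) has_vector_derivative
          (if i = k then c else 1) *\<^sub>R axis i 1) (at 0)"
proof (cases "i = k")
  case True
  have eq: "stretch k g (x + h *\<^sub>R axis k 1) = x + (g (x $ k + h) - x $ k) *\<^sub>R axis k 1" for h
    by (simp add: stretch_def vec_eq_iff axis_def)
  have "((\<lambda>h. g (x $ k + h)) has_real_derivative c) (at 0)"
    using assms DERIV_shift [of g c 0 "x $ k"] by (simp add: add.commute)
  then show ?thesis
    unfolding True eq by (auto intro!: derivative_eq_intros)
next
  case False
  then have eq: "stretch k g (x + h *\<^sub>R axis i 1) = stretch k g x + h *\<^sub>R axis i 1" for h
    by (auto simp: stretch_def vec_eq_iff axis_def)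
  show ?thesis
    using False unfolding eq by (auto intro!: derivative_eq_intros)
qed

lemma has_all_partials_stretch:
  assumes "(g has_real_derivative c) (at (x $ k))"
  shows "has_all_partials (stretch k g) x"
  unfolding has_all_partials_def has_partial_def
  using partial_stretch [OF assms] has_vector_derivative_def differentiableI by blast

lemma jac_stretch:
  assumes "(g has_real_derivative c) (at (x $ k))"
  shows "jac (stretch k g) x = (\<chi> j i. if j = i then if i = k then c else 1 else 0)"
proof -
  have "partial_at (stretch k g) i x = (if i = k then c else 1) *\<^sub>R axis i 1" for i
    unfolding partial_at_def by (rule vector_derivative_at [OF partial_stretch [OF assms]])
  then show ?thesis
    by (auto simp: jac_def vec_eq_iff axis_def)
qed

text \<open>Each component is scaled by at most \<open>max c 1\<close>, and the bound is attained at
  \<open>axis k 1\<close> or at another axis vector, which exists in dimension at least two.\<close>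

lemma onorm_axis_scaling:
  fixes k :: "'n::finite"
  assumes "CARD('n) \<ge> 2" "c \<ge> 0"
  shows "onorm (\<lambda>h. (\<chi> j i. if j = i then if i = k then c else 1 else 0 :: real^'n^'n) *v h) = max c 1"
    (is "onorm (\<lambda>h. ?A *v h) = _")
proof (rule antisym)
  have A: "(?A *v h) $ j = (if j = k then c else 1) * h $ j" for h j
    by (simp add: matrix_vector_mult_def if_distrib [of "\<lambda>u. u * _"] cong: if_cong)
  show "onorm (\<lambda>h. ?A *v h) \<le> max c 1"
  proof (rule onorm_le)
    fix h :: "real^'n"
    have "norm (?A *v h) \<le> norm (max c 1 *\<^sub>R h)"
      by (rule norm_le_componentwise_cart)
        (use \<open>c \<ge> 0\<close> mult_right_mono [of 1 "max c 1"] in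
          \<open>auto simp: A abs_mult intro!: mult_right_mono\<close>)
    then show "norm (?A *v h) \<le> max c 1 * norm h"
      using \<open>c \<ge> 0\<close> by simp
  qed
  obtain i where i: "i \<noteq> k"
  proof -
    have "\<not> (UNIV :: 'n set) \<subseteq> {k}"
      using card_mono [of "{k}" "UNIV :: 'n set"] assms(1) by auto
    then show thesis
      using that by blast
  qed
  have *: "\<bar>if j = k then c else 1\<bar> \<le> onorm (\<lambda>h. ?A *v h)" for j
  proof -
    have "?A *v axis j 1 = (if j = k then c else 1) *\<^sub>R axis j 1"
      by (auto simp: vec_eq_iff A axis_def)
    then show ?thesis
      using onorm [OF matrix_vector_mul_bounded_linear [of ?A], of "axis j 1"] by simp
  qed
  show "max c 1 \<le> onorm (\<lambda>h. ?A *v h)"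
    using *[of k] *[of i] i \<open>c \<ge> 0\<close> by simp
qed

section \<open>Dilatation of a coordinate stretch\<close>

text \<open>The value of \<open>P_dil\<close> at slope \<open>c > 0\<close>: the
  \<open>1 / (n - 1)\<close> power of \<open>max c 1 ^ n / c\<close>, simplified in each of the two
  cases.\<close>

definition stretch_dil :: "nat \<Rightarrow> real \<Rightarrow> real" where
  "stretch_dil n c = (if c \<ge> 1 then c else (1 / c) powr (1 / (real n - 1)))"

lemma P_dil_stretch:
  fixes k :: "'n::finite"
  assumes n: "CARD('n) \<ge> 2" and c: "c > 0" and g: "(g has_real_derivative c) (at (x $ k))"
  shows "P_dil (stretch k g) x = ennreal (stretch_dil CARD('n) c)"
proof -
  let ?A = "\<chi> j i. if j = i then if i = k then c else 1 else 0 :: real^'n^'n"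
  have det: "det ?A = c"
    by (subst det_diagonal) (auto simp: prod.delta)
  have *: "outer_dilatation (stretch k g) x = ennreal (max c 1 ^ CARD('n) / c)"
    using c unfolding outer_dilatation_def jac_stretch [OF g] det onorm_axis_scaling [OF n less_imp_le [OF c]]
    by (simp add: has_all_partials_stretch [OF g])
  have "(max c 1 ^ CARD('n) / c) powr (1 / (real CARD('n) - 1)) =
    (if c \<ge> 1 then c else (1 / c) powr (1 / (real CARD('n) - 1)))"
  proof (cases "c \<ge> 1")
    case True
    obtain m where m: "CARD('n) = Suc (Suc m)"
      using n by (metis add_2_eq_Suc le_Suc_ex)
    have "max c 1 ^ CARD('n) / c = c powr (real CARD('n) - 1)"
      using c True by (simp add: m powr_add flip: powr_realpow)
    then show ?thesis
      using c True n by (simp add: powr_powr)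
  qed (use c in auto)
  then show ?thesis
    using c unfolding P_dil_def * stretch_dil_def by simp
qed

text \<open>Slope 0 makes the Jacobian singular, while the other diagonal entries keep it from being
  the zero matrix; this is the infinite case of the outer dilatation.\<close>

lemma P_dil_stretch_0:
  fixes k :: "'n::finite"
  assumes n: "CARD('n) \<ge> 2" and g: "(g has_real_derivative 0) (at (x $ k))"
  shows "P_dil (stretch k g) x = top"
proof -
  let ?A = "\<chi> j i. if j = i then if i = k then 0 else 1 else 0 :: real^'n^'n"
  have "det ?A = 0"
    by (subst det_diagonal) (auto simp: prod.delta)
  moreover have "?A \<noteq> 0"
  proof
    assume "?A = 0"
    then have "(\<lambda>h. ?A *v h) = (\<lambda>h. 0)"
      by simp
    then show False
      using onorm_axis_scaling [OF n, of 0 k] by (simp only: onorm_zero) simp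
  qed
  ultimately show ?thesis
    unfolding P_dil_def outer_dilatation_def jac_stretch [OF g] by simp
qed

section \<open>Null sets and Lipschitz bounds for coordinate maps\<close>

text \<open>The set is a countable union of hyperplanes. This discards the kinks of a piecewise
  linear profile.\<close>

lemma negligible_coordinate_countable:
  fixes k :: "'n::finite"
  assumes "countable N"
  shows "negligible {x :: real^'n. x $ k \<in> N}"
proof -
  have "{x :: real^'n. x $ k \<in> N} = (\<Union>t\<in>N. {x. axis k 1 \<bullet> x = t})"
    by (auto simp: inner_axis')
  moreover have "negligible \<dots>"
    using assms by (intro negligible_countable_Union countable_image) (auto intro!: negligible_hyperplane)
  ultimately show ?thesis
    by simp
qed

lemma AE_coordinate_notin:
  fixes k :: "'n::finite"
  assumes "countable N"
  shows "AE x :: real^'n in lebesgue. x $ k \<notin> N"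
  using negligible_coordinate_countable [OF assms, of k]
  by (auto simp: negligible_iff_null_sets dest: AE_not_in)

text \<open>In the form \<open>stretch_eq\<close>, \<open>g\<close> contributes \<open>L\<close>,
  and the identity and the subtracted coordinate contribute 1 each.\<close>

lemma stretch_lipschitz:
  assumes "L-lipschitz_on UNIV g"
  shows "(L + 2)-lipschitz_on UNIV (stretch k g :: real^'n \<Rightarrow> _)"
proof (rule lipschitz_onI)
  have L: "L \<ge> 0"
    using assms by (rule lipschitz_on_nonneg)
  then show "L + 2 \<ge> 0" by simp
  fix x y :: "real^'n"
  have 1: "\<bar>g (x $ k) - g (y $ k)\<bar> \<le> L * \<bar>x $ k - y $ k\<bar>"
    using lipschitz_onD [OF assms, of "x $ k" "y $ k"] by (simp add: dist_real_def)
  have 2: "\<bar>x $ k - y $ k\<bar> \<le> norm (x - y)"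
    using component_le_norm_cart [of "x - y" k] by simp
  have "norm (stretch k g x - stretch k g y) =
      norm (x - y + ((g (x $ k) - g (y $ k)) - (x $ k - y $ k)) *\<^sub>R axis k 1)"
    by (simp add: stretch_eq algebra_simps)
  also have "\<dots> \<le> norm (x - y) + \<bar>(g (x $ k) - g (y $ k)) - (x $ k - y $ k)\<bar>"
    by (rule norm_triangle_le) simp
  also have "\<dots> \<le> norm (x - y) + (L * norm (x - y) + norm (x - y))"
    using 1 2 mult_left_mono [OF 2 L] by linarith
  finally show "dist (stretch k g x) (stretch k g y) \<le> (L + 2) * dist x y"
    by (simp add: dist_norm algebra_simps)
qed

lemma inj_stretch: "inj g \<Longrightarrow> inj (stretch k g)"
  by (auto simp: inj_def stretch_def vec_eq_iff split: if_splits)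

section \<open>The staircase function\<close>

text \<open>The length of the part of \<open>[0, t]\<close> (for \<open>t \<ge> 0\<close>) where the fractional part is below \<open>l\<close>.\<close>

definition staircase :: "real \<Rightarrow> real \<Rightarrow> real" where
  "staircase l t = l * of_int \<lfloor>t\<rfloor> + min (frac t) l"

text \<open>An increment is the length of a subset of \<open>[s, t]\<close>. If the integer parts
  differ, it is split into the rest of the first period, \<open>m\<close> full periods and the
  beginning of the last one.\<close>

lemma staircase_mono_lipschitz:
  assumes l: "0 \<le> l" "l \<le> 1" and "s \<le> t"
  shows "0 \<le> staircase l t - staircase l s \<and> staircase l t - staircase l s \<le> t - s"
proof (cases "\<lfloor>s\<rfloor> = \<lfloor>t\<rfloor>")
  case True
  then show ?thesis
    using assms by (auto simp: staircase_def frac_def min_def)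
next
  case False
  with \<open>s \<le> t\<close> have "\<lfloor>s\<rfloor> + 1 \<le> \<lfloor>t\<rfloor>"
    using floor_mono by force
  then obtain m where m: "\<lfloor>t\<rfloor> = \<lfloor>s\<rfloor> + 1 + m" "m \<ge> 0"
    by (metis le_add_diff_inverse diff_ge_0_iff_ge)
  have fr: "0 \<le> frac s" "frac s < 1" "0 \<le> frac t" "frac t < 1"
    by (auto simp: frac_lt_1)
  have ts: "t - s = frac t + m + (1 - frac s)"
    using m by (simp add: frac_def)
  have "staircase l t - staircase l s = min (frac t) l + l * m + (l - min (frac s) l)"
    using m by (simp add: staircase_def algebra_simps)
  moreover have "0 \<le> l * m" "l * m \<le> m"
    using l m by (auto intro: mult_left_le_one_le)
  moreover have "0 \<le> min (frac t) l" "min (frac t) l \<le> frac t" "0 \<le> l - min (frac s) l"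
      "l - min (frac s) l \<le> 1 - frac s"
    using fr l by auto
  ultimately show ?thesis
    unfolding ts by linarith
qed

text \<open>Both functions agree at integers, so the difference depends on \<open>frac t\<close>
  only and is a difference of two numbers in \<open>[0, 1]\<close>.\<close>

lemma staircase_close:
  assumes "0 \<le> l" "l \<le> 1"
  shows "\<bar>staircase l t - l * t\<bar> \<le> 1"
proof -
  have "staircase l t - l * t = min (frac t) l - l * frac t"
    by (simp add: staircase_def frac_def algebra_simps)
  moreover have "0 \<le> l * frac t" "l * frac t \<le> 1" "0 \<le> min (frac t) l" "min (frac t) l \<le> 1"
    using assms frac_lt_1 [of t] by (auto intro: mult_le_one)
  ultimately show ?thesis
    by linarith
qed

text \<open>The excluded points are the kinks. Between the integers \<open>n\<close> and
  \<open>n + 1\<close> the function is \<open>l * n + min (u - n) l\<close>, and near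
  \<open>t\<close> a single branch of the minimum applies.\<close>

lemma staircase_derivative:
  assumes "t \<notin> \<int>" "t - l \<notin> \<int>"
  shows "(staircase l has_real_derivative (if frac t < l then 1 else 0)) (at t)"
proof -
  define n where "n = real_of_int \<lfloor>t\<rfloor>"
  have n: "n < t" "t < n + 1"
    using assms(1) frac_gt_0_iff [of t] frac_lt_1 [of t] by (auto simp: n_def frac_def)
  have ev: "\<forall>\<^sub>F u in nhds t. n < u \<and> u < n + 1"
    using n by (intro eventually_conj order_tendstoD(1,2) [OF tendsto_ident_at] eventually_nhds_in_open
        eventually_nhds_in_open [of "{n<..}", simplified] eventually_nhds_in_open [of "{..<n+1}", simplified])
  have fl: "staircase l u = l * n + min (u - n) l" if "n < u \<and> u < n + 1" for u
  proof -
    have "\<lfloor>u\<rfloor> = \<lfloor>t\<rfloor>"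
      using that unfolding n_def by linarith
    then show ?thesis
      by (simp add: staircase_def frac_def n_def)
  qed
  have "t - n \<noteq> l"
    using assms(2) by (auto simp: n_def)
  then consider "t - n < l" | "t - n > l"
    by linarith
  then show ?thesis
  proof cases
    case 1
    then have "\<forall>\<^sub>F u in nhds t. u < n + l"
      by (intro eventually_nhds_in_open [of "{..<n+l}", simplified]) auto
    with ev have "\<forall>\<^sub>F u in nhds t. staircase l u = l * n + (u - n)"
      by eventually_elim (simp add: fl)
    moreover have "((\<lambda>u. l * n + (u - n)) has_real_derivative 1) (at t)"
      by (auto intro!: derivative_eq_intros)
    ultimately show ?thesis
      using 1 by (subst DERIV_cong_ev [OF refl _ refl]) (auto simp: frac_def n_def)
  next
    case 2
    then have "\<forall>\<^sub>F u in nhds t. u > n + l"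
      by (intro eventually_nhds_in_open [of "{n+l<..}", simplified]) auto
    with ev have "\<forall>\<^sub>F u in nhds t. staircase l u = l * n + l"
      by eventually_elim (simp add: fl)
    moreover have "((\<lambda>u. l * n + l) has_real_derivative 0) (at t)"
      by (auto intro!: derivative_eq_intros)
    ultimately show ?thesis
      using 2 by (subst DERIV_cong_ev [OF refl _ refl]) (auto simp: frac_def n_def)
  qed
qed

section \<open>Lipschitz maps are Sobolev\<close>

lemma has_partial_iff:
  "has_partial f i x \<longleftrightarrow>
    ((\<lambda>h. f (x + h *\<^sub>R axis i 1)) has_vector_derivative partial_at f i x) (at 0)"
  unfolding has_partial_def partial_at_def by (simp add: vector_derivative_works)

text \<open>The chain rule for a translation of the parameter; it allows mean value estimates along
  a coordinate line.\<close>

lemma has_partial_shift: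
  assumes "has_partial f i (x + t *\<^sub>R axis i 1)"
  shows "((\<lambda>h. f (x + h *\<^sub>R axis i 1)) has_vector_derivative partial_at f i (x + t *\<^sub>R axis i 1)) (at t)"
proof -
  have *: "((\<lambda>h. f (x + t *\<^sub>R axis i 1 + h *\<^sub>R axis i 1)) has_vector_derivative
      partial_at f i (x + t *\<^sub>R axis i 1)) (at (t - t))"
    using assms by (simp add: has_partial_iff)
  have "((\<lambda>h. h - t) has_real_derivative 1) (at t)"
    by (auto intro!: derivative_eq_intros)
  then show ?thesis
    using vector_diff_chain_at [of "\<lambda>h. h - t" 1 t, OF _ *]
    by (simp add: o_def algebra_simps has_real_derivative_iff_has_vector_derivative)
qed

lemma has_partial_quotient_LIMSEQ:
  fixes f :: "real^'n \<Rightarrow> 'b::real_normed_vector"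
  assumes "has_partial f i x" "h \<longlonglongrightarrow> 0" "\<And>n. h n \<noteq> 0"
  shows "(\<lambda>n. (f (x + h n *\<^sub>R axis i 1) - f x) /\<^sub>R h n) \<longlonglongrightarrow> partial_at f i x"
proof -
  have "((\<lambda>h. (f (x + h *\<^sub>R axis i 1) - f x) /\<^sub>R h) \<longlongrightarrow> partial_at f i x) (at 0)"
  proof (rule Lim_null [THEN iffD2], rule tendsto_norm_zero_cancel)
    have "((\<lambda>h. norm (f (x + h *\<^sub>R axis i 1) - f x - h *\<^sub>R partial_at f i x) / norm h) \<longlongrightarrow> 0) (at 0)"
      using assms(1) by (simp add: has_partial_iff has_vector_derivative_def has_derivative_at)
    then show "((\<lambda>h. norm ((f (x + h *\<^sub>R axis i 1) - f x) /\<^sub>R h - partial_at f i x)) \<longlongrightarrow> 0) (at 0)"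
    proof (rule Lim_transform_eventually)
      have "norm (y - h *\<^sub>R z) / norm h = norm (y /\<^sub>R h - z)" if "h \<noteq> 0" for y z :: 'b and h :: real
      proof -
        have "y /\<^sub>R h - z = (y - h *\<^sub>R z) /\<^sub>R h"
          using that by (simp add: algebra_simps)
        then show ?thesis
          by (simp add: divide_inverse mult.commute)
      qed
      then show "\<forall>\<^sub>F h in at 0. norm (f (x + h *\<^sub>R axis i 1) - f x - h *\<^sub>R partial_at f i x) / norm h =
          norm ((f (x + h *\<^sub>R axis i 1) - f x) /\<^sub>R h - partial_at f i x)"
        by (auto simp: eventually_at_filter)
    qed
  qed
  then show ?thesis
    by (rule filterlim_compose) (use assms(2,3) in \<open>simp add: filterlim_at\<close>)
qed

lemma translation_lborel_integral:
  fixes f :: "'a::euclidean_space \<Rightarrow> 'b::euclidean_space"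
  assumes [measurable]: "f \<in> borel_measurable borel"
  shows "(\<integral>x. f (x + c) \<partial>lborel) = (\<integral>x. f x \<partial>lborel)"
  by (subst (2) lborel_distr_plus [of c, symmetric], subst integral_distr) (auto simp: add.commute)

lemma continuous_loc_integrable:
  assumes "continuous_on UNIV f"
  shows "loc_integrable D f"
  unfolding loc_integrable_def set_integrable_def
  using borel_integrable_compact [OF _ continuous_on_subset [OF assms]]
  by (auto intro!: integrable_completion [THEN iffD2])

text \<open>The partial derivative is continuous on the compact support, and it vanishes elsewhere
  because \<phi> is zero near every point outside.\<close>

lemma test_function_bounded_partial:
  assumes "test_function D \<phi>"
  obtains M where "\<And>x. \<bar>partial_at \<phi> i x\<bar> \<le> M"
proof -
  let ?S = "closure {x. \<phi> x \<noteq> 0}"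
  have S: "compact ?S" and sm: "Ck (Suc 0) \<phi>"
    using assms by (auto simp only: test_function_def smooth_fun_def)
  then have "compact (partial_at \<phi> i ` ?S)"
    by (intro compact_continuous_image) (auto intro: continuous_on_subset)
  then obtain M where M: "\<And>x. x \<in> ?S \<Longrightarrow> \<bar>partial_at \<phi> i x\<bar> \<le> M" 
    by (force dest!: compact_imp_bounded simp: bounded_iff)
  have "partial_at \<phi> i x = 0" if "x \<notin> ?S" for x
  proof -
    have "\<forall>\<^sub>F y in nhds x. y \<in> - ?S"
      using that by (intro eventually_nhds_in_open) auto
    moreover have "((\<lambda>h. x + h *\<^sub>R axis i 1) \<longlongrightarrow> x) (nhds 0)"
      by (auto intro!: tendsto_eq_intros filterlim_ident)
    ultimately have "\<forall>\<^sub>F h in nhds 0. x + h *\<^sub>R axis i 1 \<in> - ?S"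
      by (rule eventually_compose_filterlim [of "\<lambda>y. y \<in> - ?S"])
    then have ev: "\<forall>\<^sub>F h in nhds 0. \<phi> (x + h *\<^sub>R axis i 1) = 0"
      by eventually_elim (use closure_subset [of "{x. \<phi> x \<noteq> 0}"] in auto)
    have "((\<lambda>h. \<phi> (x + h *\<^sub>R axis i 1)) has_real_derivative 0) (at 0)"
      by (subst DERIV_cong_ev [OF refl ev refl]) simp
    then show ?thesis
      unfolding partial_at_def
      by (intro vector_derivative_at) (simp add: has_real_derivative_iff_has_vector_derivative)
  qed
  \<comment> \<open>The maximum with 0 is taken because \<open>M\<close> may be negative when the
    support is empty.\<close>
  with M have "\<bar>partial_at \<phi> i x\<bar> \<le> max M 0" for x
    by (cases "x \<in> ?S") (auto simp: le_max_iff_disj)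
  then show thesis
    by (rule that)
qed

text \<open>Moving a difference quotient from the test function to \<open>F\<close> is translation invariance of
  the integral; dominated convergence then gives the integration by parts.\<close>

lemma lipschitz_W11_loc:
  fixes F :: "real^'n \<Rightarrow> real^'m"
  assumes L: "L-lipschitz_on UNIV F" and ae: "AE x in lborel. has_all_partials F x"
  shows "W11_loc D F"
proof -
  define h where "h n = inverse (real (Suc n))" for n
  have h: "h \<longlonglongrightarrow> 0" "h n > 0" "h n \<le> 1" for n
    using LIMSEQ_inverse_real_of_nat unfolding h_def by (auto simp: inverse_le_1_iff)
  \<comment> \<open>Backward quotients, since the substitution that frees \<phi> of its shift moves
    \<open>F\<close> backwards.\<close>
  define q where "q i n x = (F x - F (x - h n *\<^sub>R axis i 1)) /\<^sub>R h n" for i n x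
  \<comment> \<open>The candidate weak derivative is a pointwise \<open>lim\<close>, which is Borel
    measurable; it equals the partial derivative almost everywhere.\<close>
  define g where "g i x = lim (\<lambda>n. q i n x)" for i x
  have cF: "continuous_on UNIV F"
    using L by (rule lipschitz_on_continuous_on)
  have [measurable]: "F \<in> borel_measurable borel"
    using cF by (rule borel_measurable_continuous_onI)
  have [measurable]: "q i n \<in> borel_measurable borel" for i n
    unfolding q_def by measurable
  have [measurable]: "g i \<in> borel_measurable borel" for i
    unfolding g_def by measurable
  have qL: "norm (q i n x) \<le> L" for i n x
  proof -
    have "norm (F x - F (x - h n *\<^sub>R axis i 1)) \<le> L * h n"
      using lipschitz_onD [OF L, of x "x - h n *\<^sub>R axis i 1"] h(2)[of n] by (simp add: dist_norm)
    moreover have "norm (q i n x) = norm (F x - F (x - h n *\<^sub>R axis i 1)) / h n"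
      using h(2)[of n] unfolding q_def norm_scaleR by (simp add: divide_inverse)
    ultimately show ?thesis
      using h(2)[of n] by (simp add: pos_divide_le_eq)
  qed
  have qg: "AE x in lborel. (\<lambda>n. q i n x) \<longlonglongrightarrow> g i x" for i
    using ae
  proof eventually_elim
    case (elim x)
    have "(\<lambda>n. (F (x + (- h n) *\<^sub>R axis i 1) - F x) /\<^sub>R (- h n)) \<longlonglongrightarrow> partial_at F i x"
      using elim h tendsto_minus [OF h(1)]
      by (intro has_partial_quotient_LIMSEQ) (auto simp: has_all_partials_def less_imp_neq [THEN not_sym])
    then have "(\<lambda>n. q i n x) \<longlonglongrightarrow> partial_at F i x"
      by (simp add: q_def algebra_simps)
    then show ?case
      unfolding g_def by (simp add: limI)
  qed
  have gL: "AE x in lborel. norm (g i x) \<le> L" for i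
    using qg [of i]
  proof eventually_elim
    case (elim x)
    show ?case
      by (rule Lim_norm_ubound [OF _ elim]) (auto simp: qL)
  qed
  have "loc_integrable D (g i)" for i
    unfolding loc_integrable_def
  proof (intro allI impI)
    fix K :: "(real^'n) set"
    assume K: "compact K \<and> K \<subseteq> D"
    then have [measurable]: "K \<in> sets borel" and "emeasure lborel K < \<infinity>"
      using emeasure_compact_finite by (auto intro: borel_compact)
    then have "integrable lborel (\<lambda>x. indicator K x *\<^sub>R g i x)"
      using gL [of i] by (intro integrableI_bounded_set [where A = K and B = L]) auto
    then show "g i absolutely_integrable_on K"
      unfolding set_integrable_def by (subst integrable_completion) auto
  qed
  moreover have "integral UNIV (\<lambda>x. partial_at \<phi> i x *\<^sub>R F x) = - integral UNIV (\<lambda>x. \<phi> x *\<^sub>R g i x)"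
    if \<phi>: "test_function D \<phi>" for i \<phi>
  proof -
    have Ck: "Ck (Suc 0) \<phi>"
      using \<phi> by (auto simp only: test_function_def smooth_fun_def)
    then have c\<phi>: "continuous_on UNIV \<phi>" and "\<forall>x. has_all_partials \<phi> x"
      and "continuous_on UNIV (partial_at \<phi> i)"
      by auto
    then have p\<phi>: "has_partial \<phi> i x" for x
      unfolding has_all_partials_def by blast
    have [measurable]: "\<phi> \<in> borel_measurable borel" "partial_at \<phi> i \<in> borel_measurable borel"
      using c\<phi> \<open>continuous_on UNIV (partial_at \<phi> i)\<close> by (auto intro: borel_measurable_continuous_onI)
    have "bounded (closure {x. \<phi> x \<noteq> 0})"
      using \<phi> by (auto simp: test_function_def compact_imp_bounded)
    then obtain R where "\<And>x. x \<in> closure {x. \<phi> x \<noteq> 0} \<Longrightarrow> norm x \<le> R"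
      by (auto simp: bounded_iff)
    then have R: "\<phi> x = 0" if "norm x > R" for x
      using that closure_subset [of "{x. \<phi> x \<noteq> 0}"] by force
    \<comment> \<open>The margin 1 absorbs the shifts, as \<open>h n\<close> is at most 1; outside
      \<open>?B\<close> both \<phi> and its shift vanish.\<close>
    let ?B = "cball 0 (R + 1) :: (real^'n) set"
    obtain M where M: "\<And>x. \<bar>partial_at \<phi> i x\<bar> \<le> M"
      using test_function_bounded_partial [OF \<phi>] by blast
    have "compact (F ` ?B)" "compact (\<phi> ` ?B)"
      by (auto intro!: compact_continuous_image continuous_on_subset [OF cF] continuous_on_subset [OF c\<phi>])
    then obtain C E where C: "\<And>x. x \<in> ?B \<Longrightarrow> norm (F x) \<le> C" and E: "\<And>x. x \<in> ?B \<Longrightarrow> \<bar>\<phi> x\<bar> \<le> E"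
      by (force dest!: compact_imp_bounded simp: bounded_iff)
    have M0: "M \<ge> 0" using M [of 0] by linarith
    have B [measurable]: "?B \<in> sets borel" "emeasure lborel ?B < \<infinity>"
      using emeasure_compact_finite [of ?B] by auto
    have intB: "integrable lborel (\<lambda>x. indicator ?B x * c)" for c :: real
      using B by simp
    have out: "\<phi> x = 0" "\<phi> (x + h n *\<^sub>R axis i 1) = 0" if "x \<notin> ?B" for x n
    proof -
      have "norm x \<le> norm (x + h n *\<^sub>R axis i 1) + h n"
        using norm_triangle_ineq4 [of "x + h n *\<^sub>R axis i 1" "h n *\<^sub>R axis i 1"] h(2)[of n] by simp
      then show "\<phi> x = 0" "\<phi> (x + h n *\<^sub>R axis i 1) = 0"
        using that h(3)[of n] by (auto intro!: R)
    qed
    define p where "p n x = (\<phi> (x + h n *\<^sub>R axis i 1) - \<phi> x) / h n" for n x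
    have [measurable]: "p n \<in> borel_measurable borel" for n
      unfolding p_def by measurable
    have pM: "\<bar>p n x\<bar> \<le> M" for n x
    proof -
      \<comment> \<open>The mean value inequality on the coordinate line through \<open>x\<close>,
        with derivative bounded by \<open>M\<close>.\<close>
      have "norm (\<phi> (x + h n *\<^sub>R axis i 1) - \<phi> (x + 0 *\<^sub>R axis i 1)) \<le> M * norm (h n - 0)"
        using has_partial_shift [OF p\<phi>] M
        by (intro field_differentiable_bound [of UNIV]) 
          (auto simp: has_real_derivative_iff_has_vector_derivative)
      then show ?thesis
        using h(2)[of n] by (simp add: p_def field_simps)
    qed
    have plim: "(\<lambda>n. p n x) \<longlonglongrightarrow> partial_at \<phi> i x" for x
      using has_partial_quotient_LIMSEQ [OF p\<phi> h(1)] h(2)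
      by (simp add: p_def less_imp_neq [THEN not_sym] divide_inverse mult.commute)
    have 1: "integrable lborel (\<lambda>x. partial_at \<phi> i x *\<^sub>R F x)"
      "(\<lambda>n. \<integral>x. p n x *\<^sub>R F x \<partial>lborel) \<longlonglongrightarrow> (\<integral>x. partial_at \<phi> i x *\<^sub>R F x \<partial>lborel)"
    proof -
      have bd: "norm (p n x *\<^sub>R F x) \<le> indicator ?B x * (M * C)" for n x
      proof (cases "x \<in> ?B")
        case True
        then show ?thesis
          using mult_mono [OF pM [of n x] C [OF True]] M0 by simp
      qed (simp add: out p_def)
      show "integrable lborel (\<lambda>x. partial_at \<phi> i x *\<^sub>R F x)"
        by (rule integrable_dominated_convergence [OF _ _ intB, where s = "\<lambda>n x. p n x *\<^sub>R F x"])
          (auto intro!: tendsto_intros plim bd simp del: norm_scaleR)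
      show "(\<lambda>n. \<integral>x. p n x *\<^sub>R F x \<partial>lborel) \<longlonglongrightarrow> (\<integral>x. partial_at \<phi> i x *\<^sub>R F x \<partial>lborel)"
        by (rule integral_dominated_convergence [OF _ _ intB])
          (auto intro!: tendsto_intros plim bd simp del: norm_scaleR)
    qed
    have 2: "integrable lborel (\<lambda>x. \<phi> x *\<^sub>R g i x)"
      "(\<lambda>n. \<integral>x. \<phi> x *\<^sub>R q i n x \<partial>lborel) \<longlonglongrightarrow> (\<integral>x. \<phi> x *\<^sub>R g i x \<partial>lborel)"
    proof -
      have bd: "norm (\<phi> x *\<^sub>R q i n x) \<le> indicator ?B x * (E * L)" for n x
      proof (cases "x \<in> ?B")
        case True
        then show ?thesis
          using mult_mono [OF E [OF True] qL [of i n x]] E [OF True] by simp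
      qed (simp add: out)
      have lim: "AE x in lborel. (\<lambda>n. \<phi> x *\<^sub>R q i n x) \<longlonglongrightarrow> \<phi> x *\<^sub>R g i x"
        using qg [of i] by eventually_elim (intro tendsto_intros)
      show "integrable lborel (\<lambda>x. \<phi> x *\<^sub>R g i x)"
        by (rule integrable_dominated_convergence [OF _ _ intB lim])
          (auto intro!: bd simp del: norm_scaleR)
      show "(\<lambda>n. \<integral>x. \<phi> x *\<^sub>R q i n x \<partial>lborel) \<longlonglongrightarrow> (\<integral>x. \<phi> x *\<^sub>R g i x \<partial>lborel)"
        by (rule integral_dominated_convergence [OF _ _ intB lim])
          (auto intro!: bd simp del: norm_scaleR)
    qed
    have "(\<integral>x. p n x *\<^sub>R F x \<partial>lborel) = - (\<integral>x. \<phi> x *\<^sub>R q i n x \<partial>lborel)" for n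
    proof -
      let ?e = "h n *\<^sub>R axis i 1 :: real^'n"
      \<comment> \<open>The integrand is continuous, and the shifted \<phi> is supported in a ball
        of radius \<open>R + norm v\<close>.\<close>
      have int: "integrable lborel (\<lambda>x. \<phi> (x + v) *\<^sub>R F (x + w))" for v w
      proof -
        have "integrable lborel (\<lambda>x. indicator (cball 0 (R + norm v)) x *\<^sub>R (\<phi> (x + v) *\<^sub>R F (x + w)))"
          by (intro borel_integrable_compact continuous_intros continuous_on_compose2 [OF cF] 
              continuous_on_compose2 [OF c\<phi>]) auto
        also have "(\<lambda>x. indicator (cball 0 (R + norm v)) x *\<^sub>R (\<phi> (x + v) *\<^sub>R F (x + w))) = (\<lambda>x. \<phi> (x + v) *\<^sub>R F (x + w))"
        proof
          fix x
          have "\<phi> (x + v) = 0" if "x \<notin> cball 0 (R + norm v)"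
            using that norm_triangle_ineq4 [of "x + v" v] by (intro R) auto
          then show "indicator (cball 0 (R + norm v)) x *\<^sub>R (\<phi> (x + v) *\<^sub>R F (x + w)) = \<phi> (x + v) *\<^sub>R F (x + w)"
            by (cases "x \<in> cball 0 (R + norm v)") auto
        qed
        finally show ?thesis .
      qed
      have int': "integrable lborel (\<lambda>x. \<phi> (x + ?e) *\<^sub>R F x)" "integrable lborel (\<lambda>x. \<phi> x *\<^sub>R F x)" 
          "integrable lborel (\<lambda>x. \<phi> x *\<^sub>R F (x - ?e))"
        using int [of ?e 0] int [of 0 0] int [of 0 "- ?e"] by auto
      have "(\<integral>x. p n x *\<^sub>R F x \<partial>lborel) = (\<integral>x. inverse (h n) *\<^sub>R (\<phi> (x + ?e) *\<^sub>R F x - \<phi> x *\<^sub>R F x) \<partial>lborel)"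
        by (simp add: p_def algebra_simps divide_inverse)
      also have "\<dots> = inverse (h n) *\<^sub>R ((\<integral>x. \<phi> (x + ?e) *\<^sub>R F x \<partial>lborel) - (\<integral>x. \<phi> x *\<^sub>R F x \<partial>lborel))"
        using int' by simp
      \<comment> \<open>Translation by \<open>?e\<close> moves the shift from \<phi> to
        \<open>F\<close>; this is the discrete integration by parts.\<close>
      also have "(\<integral>x. \<phi> (x + ?e) *\<^sub>R F x \<partial>lborel) = (\<integral>x. \<phi> x *\<^sub>R F (x - ?e) \<partial>lborel)"
        using translation_lborel_integral [of "\<lambda>x. \<phi> x *\<^sub>R F (x - ?e)" ?e] by simp
      also have "inverse (h n) *\<^sub>R ((\<integral>x. \<phi> x *\<^sub>R F (x - ?e) \<partial>lborel) - (\<integral>x. \<phi> x *\<^sub>R F x \<partial>lborel)) =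
         (\<integral>x. inverse (h n) *\<^sub>R (\<phi> x *\<^sub>R F (x - ?e) - \<phi> x *\<^sub>R F x) \<partial>lborel)"
        using int' by simp
      also have "\<dots> = (\<integral>x. - (\<phi> x *\<^sub>R q i n x) \<partial>lborel)"
        by (intro Bochner_Integration.integral_cong) (auto simp: q_def algebra_simps)
      finally show ?thesis
        by simp
    qed
    then have "(\<integral>x. partial_at \<phi> i x *\<^sub>R F x \<partial>lborel) = - (\<integral>x. \<phi> x *\<^sub>R g i x \<partial>lborel)"
      using 1(2) tendsto_minus [OF 2(2)] by (simp add: LIMSEQ_unique)
    then show ?thesis
      using 1(1) 2(1) by (simp add: integral_lborel)
  qed
  ultimately show ?thesis
    unfolding W11_loc_def using continuous_loc_integrable [OF cF] by blast
qed

section \<open>Weak convergence of oscillating factors\<close>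

lemma lborel_nn_integral_translation:
  fixes f :: "'a::euclidean_space \<Rightarrow> ennreal"
  assumes [measurable]: "f \<in> borel_measurable borel"
  shows "(\<integral>\<^sup>+x. f (x - c) \<partial>lborel) = (\<integral>\<^sup>+x. f x \<partial>lborel)"
  by (subst (2) lborel_distr_plus [of "- c", symmetric], subst nn_integral_distr) (auto simp: algebra_simps)

text \<open>Lower semicontinuity of \<open>w\<close> suffices, since the positive part of \<open>w x - w (x - h)\<close>
  is dominated by \<open>w\<close>.\<close>

lemma nn_integral_shift_deficit_tendsto_0:
  fixes w :: "'a::euclidean_space \<Rightarrow> real"
  assumes [measurable]: "w \<in> borel_measurable borel" and "\<And>x. w x \<ge> 0"
    and fin: "(\<integral>\<^sup>+x. w x \<partial>lborel) < \<infinity>"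
    and lsc: "\<And>x. ((\<lambda>y. max 0 (w x - w y)) \<longlongrightarrow> 0) (nhds x)"
    and h: "h \<longlonglongrightarrow> 0"
  shows "(\<lambda>j. \<integral>\<^sup>+x. ennreal (max 0 (w x - w (x - h j))) \<partial>lborel) \<longlonglongrightarrow> 0"
proof -
  have lim: "(\<lambda>j. ennreal (max 0 (w x - w (x - h j)))) \<longlonglongrightarrow> 0" for x
  proof -
    have "(\<lambda>j. x - h j) \<longlonglongrightarrow> x"
      using tendsto_diff [OF tendsto_const h, of x] by simp
    then have "(\<lambda>j. max 0 (w x - w (x - h j))) \<longlonglongrightarrow> 0"
      by (rule filterlim_compose [OF lsc])
    then show ?thesis
      using tendsto_ennrealI by fastforce
  qed
  have "(\<lambda>j. \<integral>\<^sup>+x. ennreal (max 0 (w x - w (x - h j))) \<partial>lborel) \<longlonglongrightarrow> (\<integral>\<^sup>+x. 0 \<partial>(lborel :: 'a measure))"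
    by (rule nn_integral_dominated_convergence [where w = "\<lambda>x. ennreal (w x)"])
      (use fin assms(2) lim in \<open>auto intro!: ennreal_leI\<close>)
  then show ?thesis
    by simp
qed

text \<open>Translating the variable by \<open>\<theta> / (j + 1)\<close> along the axis and averaging over
  \<open>\<theta> \<in> [0, 1]\<close> replaces the oscillating factor by its mean; the error \<open>d j\<close>, which does not
  depend on the periodic profile, only sees how far \<open>w\<close> drops under small translations. Applied to
  a profile and to its complement this gives both bounds.\<close>

lemma oscillation_lower_bound:
  fixes w :: "real^'n \<Rightarrow> real"
  assumes w [measurable]: "w \<in> borel_measurable borel" and w0: "\<And>x. w x \<ge> 0"
    and fin: "(\<integral>\<^sup>+x. w x \<partial>lborel) < \<infinity>"
    and lsc: "\<And>x. ((\<lambda>y. max 0 (w x - w y)) \<longlongrightarrow> 0) (nhds x)"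
  obtains d :: "nat \<Rightarrow> ennreal" where "d \<longlonglongrightarrow> 0"
    "\<And>u m j. \<lbrakk>u \<in> borel_measurable borel; \<And>t. 0 \<le> u t \<and> u t \<le> 1;
       \<And>c. (\<integral>\<^sup>+\<theta>. indicator {0..1} \<theta> * ennreal (u (c - \<theta>)) \<partial>lborel) = ennreal (m::real)\<rbrakk> \<Longrightarrow>
       ennreal m * (\<integral>\<^sup>+x. w x \<partial>lborel) \<le> (\<integral>\<^sup>+x. w x * u (real (Suc j) * x $ k) \<partial>lborel) + d j"
proof -
  \<comment> \<open>The shift is scaled so that the phase \<open>real (Suc j) * x $ k\<close>
    changes by exactly \<theta>.\<close>
  define v where "v j \<theta> = (\<theta> / real (Suc j)) *\<^sub>R (axis k 1 :: real^'n)" for j \<theta>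
  define e where "e j \<theta> = (\<integral>\<^sup>+x. ennreal (max 0 (w x - w (x - v j \<theta>))) \<partial>lborel)" for j \<theta>
  have [measurable]: "(\<lambda>\<theta>. v j \<theta>) \<in> borel_measurable borel" for j
    unfolding v_def by measurable
  have e_meas [measurable]: "e j \<in> borel_measurable borel" for j
    unfolding e_def by measurable
  define d where "d j = (\<integral>\<^sup>+\<theta>. indicator {0..1} \<theta> * e j \<theta> \<partial>lborel)" for j
  have "d \<longlonglongrightarrow> (\<integral>\<^sup>+\<theta>. 0 \<partial>(lborel :: real measure))"
    unfolding d_def
  proof (rule nn_integral_dominated_convergence [where w = "\<lambda>\<theta>. indicator {0..1} \<theta> * (\<integral>\<^sup>+x. w x \<partial>lborel)"])
    show "AE \<theta> in lborel. indicator {0..1} \<theta> * e j \<theta> \<le> indicator {0..1} \<theta> * (\<integral>\<^sup>+x. w x \<partial>lborel)" for j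
      unfolding e_def using w0 by (intro AE_I2 mult_left_mono nn_integral_mono) (auto intro!: ennreal_leI)
    show "(\<integral>\<^sup>+\<theta>. indicator {0..1} (\<theta>::real) * (\<integral>\<^sup>+x. w x \<partial>lborel) \<partial>lborel) < \<infinity>"
      using fin by (simp add: nn_integral_multc)
    show "AE \<theta> in lborel. (\<lambda>j. indicator {0..1} \<theta> * e j \<theta>) \<longlonglongrightarrow> 0"
    proof (rule AE_I2)
      fix \<theta> :: real
      have "(\<lambda>j. \<theta> / real (Suc j)) \<longlonglongrightarrow> 0"
        using LIMSEQ_Suc [OF lim_const_over_n [of \<theta>]] by simp
      from tendsto_scaleR [OF this tendsto_const, of "axis k 1 :: real^'n"]
      have "(\<lambda>j. v j \<theta>) \<longlonglongrightarrow> 0"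
        by (simp add: v_def)
      from nn_integral_shift_deficit_tendsto_0 [OF w w0 fin lsc this]
      have "(\<lambda>j. e j \<theta>) \<longlonglongrightarrow> 0"
        unfolding e_def .
      then show "(\<lambda>j. indicator {0..1} \<theta> * e j \<theta>) \<longlonglongrightarrow> 0"
        by (cases "\<theta> \<in> {0..1}") auto
    qed
  qed measurable
  then have d: "d \<longlonglongrightarrow> 0"
    by simp
  moreover have "ennreal m * (\<integral>\<^sup>+x. w x \<partial>lborel) \<le> (\<integral>\<^sup>+x. w x * u (real (Suc j) * x $ k) \<partial>lborel) + d j"
    if u [measurable]: "u \<in> borel_measurable borel" and u01: "\<And>t. 0 \<le> u t \<and> u t \<le> 1"
      and mean: "\<And>c. (\<integral>\<^sup>+\<theta>. indicator {0..1} \<theta> * ennreal (u (c - \<theta>)) \<partial>lborel) = ennreal m"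
    for u m j
  proof -
    let ?J = "real (Suc j)" and ?I = "indicator {0..1} :: real \<Rightarrow> ennreal"
    let ?A = "\<integral>\<^sup>+x. w x * u (?J * x $ k) \<partial>lborel"
    have [measurable]: "(\<lambda>x::real^'n. x $ k) \<in> borel_measurable borel"
      by (intro borel_measurable_continuous_onI continuous_intros)
    \<comment> \<open>Translating by \<open>v j \<theta>\<close> shifts weight and phase together,
      so the value does not depend on \<theta>.\<close>
    have A: "(\<integral>\<^sup>+x. w (x - v j \<theta>) * u (?J * x $ k - \<theta>) \<partial>lborel) = ?A" for \<theta>
      using lborel_nn_integral_translation [of "\<lambda>x. w x * u (?J * x $ k)" "v j \<theta>"]
      by (simp add: v_def right_diff_distrib)
    \<comment> \<open>The constant \<open>m\<close> is written as the average at
      \<open>c = ?J * x $ k\<close>; exchanging the integrals leaves a shifted phase for each fixed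
      \<theta>.\<close>
    have "ennreal m * (\<integral>\<^sup>+x. w x \<partial>lborel) = (\<integral>\<^sup>+x. w x * ennreal m \<partial>lborel)"
      by (subst nn_integral_multc) (auto simp: mult.commute)
    also have "\<dots> = (\<integral>\<^sup>+x. w x * (\<integral>\<^sup>+\<theta>. ?I \<theta> * ennreal (u (?J * x $ k - \<theta>)) \<partial>lborel) \<partial>lborel)"
      by (simp add: mean)
    also have "\<dots> = (\<integral>\<^sup>+x. (\<integral>\<^sup>+\<theta>. w x * (?I \<theta> * ennreal (u (?J * x $ k - \<theta>))) \<partial>lborel) \<partial>lborel)"
      by (simp add: nn_integral_cmult)
    also have "\<dots> = (\<integral>\<^sup>+\<theta>. (\<integral>\<^sup>+x. w x * (?I \<theta> * ennreal (u (?J * x $ k - \<theta>))) \<partial>lborel) \<partial>lborel)"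
      by (rule lborel_pair.Fubini') measurable
    also have "\<dots> \<le> (\<integral>\<^sup>+\<theta>. ?I \<theta> * ?A + ?I \<theta> * e j \<theta> \<partial>lborel)"
    proof (intro nn_integral_mono)
      fix \<theta> :: real
      have "(\<integral>\<^sup>+x. w x * ennreal (u (?J * x $ k - \<theta>)) \<partial>lborel) \<le> 
          (\<integral>\<^sup>+x. ennreal (w (x - v j \<theta>) * u (?J * x $ k - \<theta>)) + ennreal (max 0 (w x - w (x - v j \<theta>))) \<partial>lborel)"
      proof (intro nn_integral_mono)
        fix x :: "real^'n"
        let ?c = "u (?J * x $ k - \<theta>)"
        \<comment> \<open>Since the profile lies in \<open>[0, 1]\<close>, replacing
          \<open>w x\<close> by \<open>w (x - v j \<theta>)\<close> costs at most the positive part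
          of their difference.\<close>
        have "(w x - w (x - v j \<theta>)) * ?c \<le> max 0 (w x - w (x - v j \<theta>)) * ?c"
          using u01 by (intro mult_right_mono) auto
        also have "\<dots> \<le> max 0 (w x - w (x - v j \<theta>))"
          using u01 by (intro mult_right_le_one_le) auto
        finally have "w x * ?c \<le> w (x - v j \<theta>) * ?c + max 0 (w x - w (x - v j \<theta>))"
          by (simp add: algebra_simps)
        then show "w x * ennreal ?c \<le> ennreal (w (x - v j \<theta>) * ?c) + ennreal (max 0 (w x - w (x - v j \<theta>)))"
          using w0 u01 by (simp add: ennreal_leI flip: ennreal_mult ennreal_plus)
      qed
      also have "\<dots> = ?A + e j \<theta>"
        by (subst nn_integral_add) (simp_all add: A e_def del: of_nat_Suc)
      finally have "(\<integral>\<^sup>+x. w x * ennreal (u (?J * x $ k - \<theta>)) \<partial>lborel) \<le> ?A + e j \<theta>" .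
      then show "(\<integral>\<^sup>+x. w x * (?I \<theta> * ennreal (u (?J * x $ k - \<theta>))) \<partial>lborel) \<le> ?I \<theta> * ?A + ?I \<theta> * e j \<theta>"
        by (cases "\<theta> \<in> {0..1}") auto
    qed
    also have "\<dots> = ?A + d j"
      by (subst nn_integral_add) (auto simp: nn_integral_multc d_def)
    finally show ?thesis .
  qed
  ultimately show thesis
    by (rule that)
qed

section \<open>Averages of a two-valued periodic profile\<close>

text \<open>Over one full period the profile is 1 on a set of length \<open>l\<close>, whatever the
  phase \<open>c\<close>.\<close>

lemma frac_duty_cycle:
  assumes "0 \<le> l" "l \<le> 1"
  shows "(\<integral>\<^sup>+\<theta>. indicator {0..1} \<theta> * ennreal (if frac (c - \<theta>) < l then 1 else 0) \<partial>lborel) = ennreal l"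
proof -
  define r where "r = frac c"
  have r: "0 \<le> r" "r < 1"
    by (auto simp: r_def frac_lt_1)
  have fr: "frac (c - \<theta>) = (if \<theta> \<le> r then r - \<theta> else r - \<theta> + 1)" if "0 \<le> \<theta>" "\<theta> < 1" for \<theta>
  proof -
    have "c - r \<in> \<int>"
      by (simp add: r_def frac_def)
    moreover have "c - \<theta> - (r - \<theta>) = c - r" "c - \<theta> - (r - \<theta> + 1) = (c - r) - 1"
      by simp_all
    ultimately have "c - \<theta> - (r - \<theta>) \<in> \<int>" "c - \<theta> - (r - \<theta> + 1) \<in> \<int>"
      by (simp_all only: Ints_diff Ints_1)
    then show ?thesis
      unfolding frac_unique_iff using that r by auto
  qed
  \<comment> \<open>Going back from \<open>r\<close> by the length \<open>l\<close> either stays in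
    \<open>[0, r]\<close> or wraps around, leaving the length \<open>l - r\<close> at the upper end
    of the period.\<close>
  let ?S = "if l \<le> r then {r - l<..r} else {0..r} \<union> {r + 1 - l<..<1}"
  have "AE \<theta> in lborel. indicator {0..1} \<theta> * ennreal (if frac (c - \<theta>) < l then 1 else 0) = indicator ?S \<theta>"
    using AE_lborel_singleton [of 1]
  proof eventually_elim
    case (elim \<theta>)
    then show ?case
      using r assms by (cases "0 \<le> \<theta> \<and> \<theta> < 1") (auto simp: fr split: split_indicator)
  qed
  then have "(\<integral>\<^sup>+\<theta>. indicator {0..1} \<theta> * ennreal (if frac (c - \<theta>) < l then 1 else 0) \<partial>lborel) = emeasure lborel ?S"
    by (subst nn_integral_cong_AE) auto
  also have "\<dots> = ennreal l"
  proof (cases "l \<le> r")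
    case False
    then have "emeasure lborel ({0..r} \<union> {r + 1 - l<..<1}) = ennreal r + ennreal (l - r)"
      using r assms by (subst plus_emeasure [symmetric]) auto
    then show ?thesis
      using False r by (simp flip: ennreal_plus)
  qed (use assms in auto)
  finally show ?thesis .
qed

text \<open>The lower bound holds for the profile and for its complement, whose integrals add up to
  the mass of \<open>w\<close>. Each integral is thereby squeezed to its share of the mass, and the
  claim follows by linearity.\<close>

lemma oscillating_integral_tendsto:
  fixes w :: "real^'n \<Rightarrow> real" and \<alpha> \<beta> :: ennreal
  assumes w [measurable]: "w \<in> borel_measurable borel" and w0: "\<And>x. w x \<ge> 0"
    and fin: "(\<integral>\<^sup>+x. w x \<partial>lborel) < \<infinity>"
    and lsc: "\<And>x. ((\<lambda>y. max 0 (w x - w y)) \<longlongrightarrow> 0) (nhds x)"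
    and l: "0 \<le> l" "l \<le> 1" and ab: "\<alpha> < \<infinity>" "\<beta> < \<infinity>"
  shows "(\<lambda>j. \<integral>\<^sup>+x. w x * (if frac (real (Suc j) * x $ k) < l then \<alpha> else \<beta>) \<partial>lborel)
    \<longlonglongrightarrow> (ennreal l * \<alpha> + ennreal (1 - l) * \<beta>) * (\<integral>\<^sup>+x. w x \<partial>lborel)"
proof -
  obtain d where d: "d \<longlonglongrightarrow> (0::ennreal)" and dl:
    "\<And>u m j. \<lbrakk>u \<in> borel_measurable borel; \<And>t. 0 \<le> u t \<and> u t \<le> 1;
       \<And>c. (\<integral>\<^sup>+\<theta>. indicator {0..1} \<theta> * ennreal (u (c - \<theta>)) \<partial>lborel) = ennreal (m::real)\<rbrakk> \<Longrightarrow>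
       ennreal m * (\<integral>\<^sup>+x. w x \<partial>lborel) \<le> (\<integral>\<^sup>+x. w x * u (real (Suc j) * x $ k) \<partial>lborel) + d j"
    using oscillation_lower_bound [OF w w0 fin lsc, of k] by blast
  have [measurable]: "(\<lambda>x::real^'n. x $ k) \<in> borel_measurable borel"
    by (intro borel_measurable_continuous_onI continuous_intros)
  have [measurable]: "(frac :: real \<Rightarrow> real) \<in> borel_measurable borel"
    unfolding frac_def by measurable
  let ?u = "\<lambda>t. if frac t < l then 1 else 0 :: real"
  let ?u' = "\<lambda>t. if frac t < l then 0 else 1 :: real"
  define A where "A j = (\<integral>\<^sup>+x. w x * ?u (real (Suc j) * x $ k) \<partial>lborel)" for j
  define A' where "A' j = (\<integral>\<^sup>+x. w x * ?u' (real (Suc j) * x $ k) \<partial>lborel)" for j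
  define W where "W = enn2real (\<integral>\<^sup>+x. w x \<partial>lborel)"
  have W: "(\<integral>\<^sup>+x. w x \<partial>lborel) = ennreal W" "W \<ge> 0"
    using fin by (auto simp: W_def)
  have mean': "(\<integral>\<^sup>+\<theta>. indicator {0..1} \<theta> * ennreal (?u' (c - \<theta>)) \<partial>lborel) = ennreal (1 - l)" for c
  proof -
    have "(\<integral>\<^sup>+\<theta>. indicator {0..1} \<theta> * ennreal (?u' (c - \<theta>)) \<partial>lborel) + ennreal l =
       (\<integral>\<^sup>+\<theta>. indicator {0..1} \<theta> * ennreal (?u' (c - \<theta>)) + indicator {0..1} \<theta> * ennreal (?u (c - \<theta>)) \<partial>lborel)"
      unfolding frac_duty_cycle [OF l, of c, symmetric] by (rule nn_integral_add [symmetric]) measurable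
    also have "\<dots> = (\<integral>\<^sup>+\<theta>. indicator {0..1} \<theta> \<partial>(lborel :: real measure))"
      by (intro nn_integral_cong) auto
    also have "\<dots> = ennreal (1 - l) + ennreal l"
      using l by (simp flip: ennreal_plus)
    finally show ?thesis
      by simp
  qed
  have sum: "A j + A' j = ennreal W" for j
  proof -
    have "A j + A' j = (\<integral>\<^sup>+x. w x * ?u (real (Suc j) * x $ k) + w x * ?u' (real (Suc j) * x $ k) \<partial>lborel)"
      unfolding A_def A'_def by (subst nn_integral_add [symmetric]) (auto intro!: nn_integral_cong)
    also have "\<dots> = (\<integral>\<^sup>+x. w x \<partial>lborel)"
      by (intro nn_integral_cong) auto
    finally show ?thesis
      by (simp add: W)
  qed
  have lA: "ennreal (l * W) \<le> A j + d j" for j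
    using dl [of ?u l j] frac_duty_cycle [OF l] l W by (simp add: A_def ennreal_mult)
  have lA': "ennreal ((1 - l) * W) \<le> A' j + d j" for j
    using dl [of ?u' "1 - l" j] mean' l W by (simp add: A'_def ennreal_mult)
  define a where "a j = enn2real (A j)" for j
  have AW: "A j \<le> ennreal W" for j
    unfolding sum [of j, symmetric] by simp
  have A: "A j = ennreal (a j)" "0 \<le> a j" "a j \<le> W" for j
    using AW [of j] le_less_trans [OF AW ennreal_less_top, of j] W(2) by (auto simp: a_def enn2real_leI)
  have A': "A' j = ennreal (W - a j)" for j
  proof -
    have "ennreal (a j) + A' j = ennreal (a j) + ennreal (W - a j)"
      using sum [of j] A [of j] by (simp flip: ennreal_plus)
    then show ?thesis
      by (simp add: ennreal_add_left_cancel)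
  qed
  \<comment> \<open>Eventually the error is finite, so both lower bounds become real inequalities
    for \<open>a j\<close>.\<close>
  have "\<forall>\<^sub>F j in sequentially. d j < 1"
    using d by (rule order_tendstoD) simp
  then have ev: "\<forall>\<^sub>F j in sequentially. \<bar>a j - l * W\<bar> \<le> enn2real (d j)"
  proof eventually_elim
    case (elim j)
    then obtain e where e: "d j = ennreal e" "e \<ge> 0"
      by (metis ennreal_cases not_top_less  ennreal_top_neq_one less_irrefl)
    show ?case
      using lA [of j] lA' [of j] A [of j] e l W unfolding A A' e
      by (simp add: algebra_simps flip: ennreal_plus)
  qed
  have "(\<lambda>j. enn2real (d j)) \<longlonglongrightarrow> 0"
    using tendsto_enn2real [of d 0] d by simp
  then have "(\<lambda>j. a j - l * W) \<longlonglongrightarrow> 0"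
    by (rule Lim_null_comparison [rotated]) (use ev in simp)
  then have "a \<longlonglongrightarrow> l * W"
    by (simp add: LIM_zero_iff)
  then have "(\<lambda>j. \<alpha> * A j + \<beta> * A' j) \<longlonglongrightarrow> \<alpha> * ennreal (l * W) + \<beta> * ennreal (W - l * W)"
    unfolding A A' using ab by (intro tendsto_add ennreal_tendsto_cmult tendsto_ennrealI tendsto_diff tendsto_const) auto
  moreover have "\<alpha> * ennreal (l * W) + \<beta> * ennreal (W - l * W) = (ennreal l * \<alpha> + ennreal (1 - l) * \<beta>) * ennreal W"
  proof -
    have "ennreal (l * W) = ennreal l * ennreal W" "ennreal (W - l * W) = ennreal (1 - l) * ennreal W"
      using l W by (simp_all add: algebra_simps flip: ennreal_mult)
    then show ?thesis
      by (simp only: distrib_left distrib_right mult_ac)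
  qed
  moreover have "\<alpha> * A j + \<beta> * A' j = (\<integral>\<^sup>+x. w x * (if frac (real (Suc j) * x $ k) < l then \<alpha> else \<beta>) \<partial>lborel)" for j
    unfolding A_def A'_def
    by (subst (1 2) nn_integral_cmult [symmetric], measurable, subst nn_integral_add [symmetric], measurable)
      (auto intro!: nn_integral_cong simp: mult.commute)
  ultimately show ?thesis
    by (simp add: W)
qed

section \<open>Failure of semicontinuity\<close>

lemma stretch_dil_ge_1: "n \<ge> 2 \<Longrightarrow> c > 0 \<Longrightarrow> stretch_dil n c \<ge> 1"
  by (auto simp: stretch_dil_def intro!: ge_one_powr_ge_zero)

text \<open>For each stretching slope \<open>t > 1\<close> there is a compressing slope with the
  same dilatation; this makes averages of smaller dilatation available.\<close>

lemma stretch_dil_inverse_power: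
  assumes "n \<ge> 2" "t > 1"
  shows "stretch_dil n (1 / t ^ (n - 1)) = t"
proof -
  have "t ^ (n - 1) = t powr (real n - 1)"
    using assms by (simp add: of_nat_diff flip: powr_realpow)
  moreover have "t ^ (n - 1) > 1"
    using assms by (intro one_less_power) auto
  then have "\<not> 1 \<le> 1 / t ^ (n - 1)"
    by (simp only: not_le divide_less_eq_1_pos)
  ultimately have "\<not> 1 \<le> 1 / t ^ (n - 1)" "1 / (1 / t ^ (n - 1)) = t powr (real n - 1)"
    by simp_all
  then show ?thesis
    using assms by (simp only: stretch_dil_def if_False) (simp add: powr_powr)
qed

section \<open>Oscillating piecewise linear functions\<close>

text \<open>The period is \<open>1 / real (Suc j)\<close>; the slope is \<open>a\<close> on the
  first fraction \<open>l\<close> of each period and \<open>b\<close> on the rest.\<close>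

definition zigzag :: "real \<Rightarrow> real \<Rightarrow> real \<Rightarrow> nat \<Rightarrow> real \<Rightarrow> real" where
  "zigzag a b l j t = b * t + (a - b) * (staircase l (real (Suc j) * t) / real (Suc j))"

text \<open>Here \<open>d\<close> is the length of the part of \<open>[s, t]\<close> with slope
  \<open>a\<close>. For positive slopes the Lipschitz bound and injectivity both follow.\<close>

lemma zigzag_increment:
  assumes "0 \<le> l" "l \<le> 1" "s \<le> t"
  obtains d where "0 \<le> d" "d \<le> t - s" "zigzag a b l j t - zigzag a b l j s = b * (t - s - d) + a * d"
proof
  define J where "J = real (Suc j)"
  have J: "J > 0"
    by (simp add: J_def)
  have zz: "zigzag a b l j u = b * u + (a - b) * (staircase l (J * u) / J)" for u
    by (simp only: zigzag_def J_def)
  let ?d = "(staircase l (J * t) - staircase l (J * s)) / J"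
  have "0 \<le> staircase l (J * t) - staircase l (J * s) \<and>
      staircase l (J * t) - staircase l (J * s) \<le> J * t - J * s"
    using assms J by (intro staircase_mono_lipschitz) auto
  then show "0 \<le> ?d" "?d \<le> t - s"
    using J by (auto simp: field_simps)
  show "zigzag a b l j t - zigzag a b l j s = b * (t - s - ?d) + a * ?d"
    by (simp add: zz diff_divide_distrib algebra_simps)
qed

lemma zigzag_lipschitz:
  assumes "0 \<le> l" "l \<le> 1" "a > 0" "b > 0"
  shows "(a + b)-lipschitz_on UNIV (zigzag a b l j)"
proof (rule lipschitz_on_leI)
  fix s t :: real
  assume "s \<le> t"
  then obtain d where d: "0 \<le> d" "d \<le> t - s"
    and eq: "zigzag a b l j t - zigzag a b l j s = b * (t - s - d) + a * d"
    using zigzag_increment [OF assms(1,2)] by blast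
  have "0 \<le> b * (t - s - d)" "b * (t - s - d) \<le> b * (t - s)" "0 \<le> a * d" "a * d \<le> a * (t - s)"
    using assms d by auto
  then have "\<bar>zigzag a b l j t - zigzag a b l j s\<bar> \<le> b * (t - s) + a * (t - s)"
    unfolding eq by linarith
  then show "dist (zigzag a b l j s) (zigzag a b l j t) \<le> (a + b) * dist s t"
    using \<open>s \<le> t\<close> by (simp add: dist_real_def algebra_simps)
qed (use assms in auto)

lemma inj_zigzag:
  assumes "0 \<le> l" "l \<le> 1" "a > 0" "b > 0"
  shows "inj (zigzag a b l j)"
proof (rule linorder_injI)
  fix s t :: real
  assume "s < t"
  then obtain d where d: "0 \<le> d" "d \<le> t - s"
    and eq: "zigzag a b l j t - zigzag a b l j s = b * (t - s - d) + a * d"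
    using zigzag_increment [OF assms(1,2), of s t] by (metis less_imp_le)
  have "b * (t - s - d) + a * d > 0"
  proof (cases "d = 0")
    case False
    then show ?thesis
      using assms d by (intro add_nonneg_pos) auto
  qed (use assms \<open>s < t\<close> in auto)
  with eq show "zigzag a b l j s \<noteq> zigzag a b l j t"
    by linarith
qed

text \<open>Rescaling divides the staircase error, which is at most 1, by
  \<open>real (Suc j)\<close>; the bound is uniform on the whole line.\<close>

lemma zigzag_close:
  assumes "0 \<le> l" "l \<le> 1"
  shows "\<bar>zigzag a b l j t - (l * a + (1 - l) * b) * t\<bar> \<le> \<bar>a - b\<bar> / real (Suc j)"
proof -
  define J where "J = real (Suc j)"
  have J: "J > 0"
    by (simp add: J_def)
  have "zigzag a b l j t - (l * a + (1 - l) * b) * t = (a - b) * (staircase l (J * t) - l * (J * t)) / J"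
    using J unfolding zigzag_def J_def [symmetric] by (simp add: field_simps)
  also have "\<bar>\<dots>\<bar> \<le> \<bar>a - b\<bar> * 1 / J"
    unfolding abs_divide abs_mult
    using J staircase_close [OF assms, of "J * t"] by (intro divide_right_mono mult_left_mono frac_le) auto
  finally show ?thesis
    by (simp add: J_def)
qed

text \<open>The exceptional set consists of the rescaled kinks of the staircase.\<close>

lemma zigzag_derivative:
  obtains N where "countable N" "\<And>t. t \<notin> N \<Longrightarrow>
    (zigzag a b l j has_real_derivative (if frac (real (Suc j) * t) < l then a else b)) (at t)"
proof
  define J where "J = real (Suc j)"
  have J: "J > 0"
    by (simp add: J_def)
  let ?N = "(\<lambda>u. u / J) ` \<int> \<union> (\<lambda>u. (u + l) / J) ` \<int>"
  have "countable (\<int> :: real set)"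
    by (simp add: Ints_def)
  then show "countable ?N"
    by simp
  fix t
  assume t: "t \<notin> ?N"
  have "J * t \<notin> \<int>" "J * t - l \<notin> \<int>"
  proof -
    have "t = (J * t) / J" "t = ((J * t - l) + l) / J"
      using J by auto
    then show "J * t \<notin> \<int>" "J * t - l \<notin> \<int>"
      using t by blast+
  qed
  then have "(staircase l has_real_derivative (if frac (J * t) < l then 1 else 0)) (at (J * t))"
    by (rule staircase_derivative)
  then have "((\<lambda>t. staircase l (J * t)) has_real_derivative (if frac (J * t) < l then 1 else 0) * J) (at t)"
    by (rule DERIV_chain2) (auto intro!: derivative_eq_intros)
  then have "((\<lambda>t. b * t + (a - b) * (staircase l (J * t) / J)) has_real_derivative
      b + (a - b) * ((if frac (J * t) < l then 1 else 0) * J / J)) (at t)"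
    by (auto intro!: derivative_eq_intros)
  moreover have "b + (a - b) * ((if frac (J * t) < l then 1 else 0) * J / J) = (if frac (J * t) < l then a else b)"
    using J by simp
  ultimately show "(zigzag a b l j has_real_derivative (if frac (real (Suc j) * t) < l then a else b)) (at t)"
    unfolding zigzag_def [abs_def] J_def [symmetric] by simp
qed

section \<open>Reduction to functions of one variable\<close>

text \<open>The conclusion of the theorem, named so that the cases can share it. For empty \<Omega>
  both integrals would be 0, so the strict inequality is asserted for nonempty \<Omega>.\<close>

definition semicontinuity_fails :: "(real^'n) set \<Rightarrow> (ennreal \<Rightarrow> ennreal) \<Rightarrow> bool" where
  "semicontinuity_fails D \<Phi> \<longleftrightarrow> (\<exists>(fs :: nat \<Rightarrow> real^'n \<Rightarrow> real^'n) (f :: real^'n \<Rightarrow> real^'n).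
           (\<forall>j. (\<exists>g. homeomorphism D (fs j ` D) (fs j) g) \<and> W11_loc D (fs j)) \<and>
           (\<forall>K. compact K \<and> K \<subseteq> D \<longrightarrow> uniform_limit K fs f sequentially) \<and>
           (AE x in lebesgue. x \<in> D \<longrightarrow> f differentiable (at x)) \<and>
           (\<forall>\<Omega> (\<Psi> :: real^'n \<Rightarrow> real).
              open \<Omega> \<and> bounded \<Omega> \<and> \<Omega> \<noteq> {} \<and> \<Omega> \<subseteq> D \<and> continuous_on UNIV \<Psi> \<and> (\<forall>x. 0 < \<Psi> x) \<longrightarrow>
              Phi_integral \<Phi> \<Psi> \<Omega> f > limsup (\<lambda>j. Phi_integral \<Phi> \<Psi> \<Omega> (fs j))))"

text \<open>The last clause is lower semicontinuity of \<open>w\<close>, as it holds for a positive continuous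
  function cut off outside an open set.\<close>

definition weight :: "(real^'n \<Rightarrow> real) \<Rightarrow> bool" where
  "weight w \<longleftrightarrow> w \<in> borel_measurable borel \<and> (\<forall>x. w x \<ge> 0) \<and>
     0 < (\<integral>\<^sup>+x. w x \<partial>lborel) \<and> (\<integral>\<^sup>+x. w x \<partial>lborel) < \<infinity> \<and>
     (\<forall>x. ((\<lambda>y. max 0 (w x - w y)) \<longlongrightarrow> 0) (nhds x))"

text \<open>The mass is positive because a nonempty open set is not negligible, and finite because
  \<Psi> is integrable over the compact closure. Lower semicontinuity is continuity inside \<Omega>
  and is trivial outside, where the weight is 0.\<close>

lemma weight_indicator_times:
  fixes \<Psi> :: "real^'n \<Rightarrow> real"
  assumes \<Omega>: "open \<Omega>" "bounded \<Omega>" "\<Omega> \<noteq> {}"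
    and c: "continuous_on UNIV \<Psi>" and pos: "\<And>x. 0 < \<Psi> x"
  shows "weight (\<lambda>x. indicator \<Omega> x * \<Psi> x)" (is "weight ?w")
proof -
  have [measurable]: "\<Psi> \<in> borel_measurable borel" "\<Omega> \<in> sets borel"
    using c \<Omega> by (auto intro: borel_measurable_continuous_onI)
  have w0: "?w x \<ge> 0" for x
    using pos [of x] by simp
  have "(\<integral>\<^sup>+x. ?w x \<partial>lborel) \<noteq> 0"
  proof
    assume "(\<integral>\<^sup>+x. ?w x \<partial>lborel) = 0"
    then have "AE x in lborel. ennreal (?w x) = 0"
      by (subst (asm) nn_integral_0_iff_AE) auto
    then have "AE x in lebesgue. x \<notin> \<Omega>"
      by (auto elim!: AE_mp [OF AE_completion] simp: ennreal_eq_0_iff mult_le_0_iff less_imp_le pos not_le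
          split: split_indicator_asm)
    then have "negligible \<Omega>"
      using \<Omega>(1) by (simp add: negligible_iff_null_sets AE_iff_null_sets)
    then show False
      using \<Omega> open_not_negligible by blast
  qed
  moreover have "(\<integral>\<^sup>+x. ?w x \<partial>lborel) < \<infinity>"
  proof -
    have cl: "compact (closure \<Omega>)"
      using \<Omega> by (simp add: compact_closure)
    have "integrable lborel (\<lambda>x. indicator (closure \<Omega>) x *\<^sub>R \<Psi> x)"
      by (rule borel_integrable_compact [OF cl continuous_on_subset [OF c]]) simp
    then have "(\<integral>\<^sup>+x. norm (indicator (closure \<Omega>) x *\<^sub>R \<Psi> x) \<partial>lborel) < \<infinity>"
      by (simp add: integrable_iff_bounded)
    moreover have "(\<integral>\<^sup>+x. ?w x \<partial>lborel) \<le> (\<integral>\<^sup>+x. norm (indicator (closure \<Omega>) x *\<^sub>R \<Psi> x) \<partial>lborel)"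
      using closure_subset [of \<Omega>] pos
      by (intro nn_integral_mono ennreal_leI) (auto split: split_indicator simp: less_imp_le)
    ultimately show ?thesis
      by (rule order_le_less_trans [rotated])
  qed
  moreover have "((\<lambda>y. max 0 (?w x - ?w y)) \<longlongrightarrow> 0) (nhds x)" for x
  proof (cases "x \<in> \<Omega>")
    case True
    have "(\<Psi> \<longlongrightarrow> \<Psi> x) (nhds x)"
      using c by (simp add: continuous_on_def tendsto_at_iff_tendsto_nhds)
    then have "((\<lambda>y. max 0 (\<Psi> x - \<Psi> y)) \<longlongrightarrow> max 0 (\<Psi> x - \<Psi> x)) (nhds x)"
      by (intro tendsto_intros)
    moreover have "\<forall>\<^sub>F y in nhds x. y \<in> \<Omega>"
      using True \<Omega>(1) by (rule eventually_nhds_in_open [rotated])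
    then have "\<forall>\<^sub>F y in nhds x. max 0 (\<Psi> x - \<Psi> y) = max 0 (?w x - ?w y)"
      by eventually_elim (use True in simp)
    ultimately show ?thesis
      by (auto intro: Lim_transform_eventually)
  next
    case False
    then have "max 0 (?w x - ?w y) = 0" for y
      using w0 [of y] by simp
    then show ?thesis
      by simp
  qed
  ultimately show ?thesis
    unfolding weight_def using w0 by (auto simp: zero_less_iff_neq_zero)
qed

text \<open>\<Phi> may be non-measurable; the nonnegative integral still ignores null sets and is
  unchanged by completing the measure.\<close>

lemma Phi_integral_AE:
  assumes "AE x in lebesgue. P_dil f x = q x" and "\<And>x. 0 < \<Psi> x"
  shows "Phi_integral \<Phi> \<Psi> \<Omega> f = (\<integral>\<^sup>+x. ennreal (indicator \<Omega> x * \<Psi> x) * \<Phi> (q x) \<partial>lborel)"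
proof -
  have "AE x in lebesgue. indicator \<Omega> x * \<Phi> (P_dil f x) * ennreal (\<Psi> x) =
      ennreal (indicator \<Omega> x * \<Psi> x) * \<Phi> (q x)"
    using assms(1) by eventually_elim (auto simp: mult.commute split: split_indicator)
  then have "Phi_integral \<Phi> \<Psi> \<Omega> f =
      (\<integral>\<^sup>+x. ennreal (indicator \<Omega> x * \<Psi> x) * \<Phi> (q x) \<partial>lebesgue)"
    unfolding Phi_integral_def by (rule nn_integral_cong_AE)
  then show ?thesis
    by (simp only: nn_integral_completion)
qed

text \<open>Lipschitz profiles give Sobolev maps, and countable exceptional sets determine the
  dilatation almost everywhere. What remains is an inequality for arbitrary weights, free of
  \<Omega> and \<Psi>.\<close>

lemma semicontinuity_failsI:
  fixes D :: "(real^'n) set" and \<Phi> :: "ennreal \<Rightarrow> ennreal" and k :: 'n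
  assumes n: "CARD('n) \<ge> 2" and D: "open D"
    and inj: "\<And>j. inj (g j)" and lip: "\<And>j. \<exists>L. L-lipschitz_on UNIV (g j)"
    and N: "\<And>j. countable (N j)"
    and der: "\<And>j t. t \<notin> N j \<Longrightarrow> (g j has_real_derivative g' j t) (at t) \<and> 0 < g' j t"
    and lim: "\<And>r. uniform_limit (cball 0 r) g (\<lambda>t. c * t) sequentially"
    and q: "\<And>x. P_dil (stretch k (\<lambda>t. c * t)) x = q"
    and int: "\<And>w :: real^'n \<Rightarrow> real. weight w \<Longrightarrow>
      limsup (\<lambda>j. \<integral>\<^sup>+x. w x * \<Phi> (ennreal (stretch_dil CARD('n) (g' j (x $ k)))) \<partial>lborel) <
      (\<integral>\<^sup>+x. w x \<partial>lborel) * \<Phi> q"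
  shows "semicontinuity_fails D \<Phi>"
  unfolding semicontinuity_fails_def
proof (rule exI [of _ "\<lambda>j. stretch k (g j)"], rule exI [of _ "stretch k (\<lambda>t. c * t)"],
    intro conjI allI impI)
  let ?fs = "\<lambda>j. stretch k (g j)"
  fix j
  obtain L where L: "(L + 2)-lipschitz_on UNIV (?fs j)"
    using lip stretch_lipschitz by blast
  have "continuous_on D (?fs j)"
    using lipschitz_on_continuous_on [OF L] continuous_on_subset by blast
  \<comment> \<open>Invariance of domain: a continuous injection on an open set is a homeomorphism
    onto its image.\<close>
  then show "\<exists>h. homeomorphism D (?fs j ` D) (?fs j) h"
    using invariance_of_domain_homeomorphism [OF D] inj_stretch [OF inj]
    by (metis inj_on_subset order_refl subset_UNIV)
  have "AE x in lebesgue. has_all_partials (?fs j) x"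
    using AE_coordinate_notin [OF N [of j], of k] by eventually_elim (metis der has_all_partials_stretch)
  then have "AE x in lborel. has_all_partials (?fs j) x"
    by (simp add: AE_completion_iff)
  with L show "W11_loc D (?fs j)"
    by (rule lipschitz_W11_loc)
next
  let ?fs = "\<lambda>j. stretch k (g j)" and ?f = "stretch k (\<lambda>t. c * t)"
  fix K :: "(real^'n) set"
  assume "compact K \<and> K \<subseteq> D"
  then have "bounded K"
    by (simp add: compact_imp_bounded)
  then obtain r where r: "\<forall>x\<in>K. norm x \<le> r"
    by (auto simp: bounded_iff)
  show "uniform_limit K ?fs ?f sequentially"
  proof (rule uniform_limitI)
    fix e :: real
    assume "e > 0"
    from uniform_limitD [OF lim this, of r]
    show "\<forall>\<^sub>F j in sequentially. \<forall>x\<in>K. dist (?fs j x) (?f x) < e"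
    proof eventually_elim
      case (elim j)
      show ?case
      proof
        fix x
        assume "x \<in> K"
        then have "\<bar>x $ k\<bar> \<le> r"
          using r component_le_norm_cart [of x k] by force
        moreover have "?fs j x - ?f x = (g j (x $ k) - c * x $ k) *\<^sub>R axis k 1"
          by (simp add: stretch_eq algebra_simps)
        then have "dist (?fs j x) (?f x) = \<bar>g j (x $ k) - c * x $ k\<bar>"
          by (simp add: dist_norm)
        ultimately show "dist (?fs j x) (?f x) < e"
          using elim by (auto simp: dist_real_def)
      qed
    qed
  qed
next
  have "bounded_linear (stretch k (\<lambda>t. c * t))"
    by (intro linear_linear [THEN iffD2] linearI)
      (auto simp: stretch_def vec_eq_iff algebra_simps)
  then show "AE x in lebesgue. x \<in> D \<longrightarrow> stretch k (\<lambda>t. c * t) differentiable at x"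
    by (auto intro: bounded_linear_imp_differentiable)
next
  fix \<Omega> and \<Psi> :: "real^'n \<Rightarrow> real"
  assume *: "open \<Omega> \<and> bounded \<Omega> \<and> \<Omega> \<noteq> {} \<and> \<Omega> \<subseteq> D \<and> continuous_on UNIV \<Psi> \<and> (\<forall>x. 0 < \<Psi> x)"
  then have w: "weight (\<lambda>x. indicator \<Omega> x * \<Psi> x)"
    by (intro weight_indicator_times) auto
  have "AE x in lebesgue. P_dil (stretch k (g j)) x = ennreal (stretch_dil CARD('n) (g' j (x $ k)))" for j
  proof -
    show ?thesis
      using AE_coordinate_notin [OF N [of j], of k]
    proof eventually_elim
      case (elim x)
      with der have "(g j has_real_derivative g' j (x $ k)) (at (x $ k))" "0 < g' j (x $ k)"
        by auto
      then show ?case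
        by (intro P_dil_stretch [OF n])
    qed
  qed
  then have fs: "Phi_integral \<Phi> \<Psi> \<Omega> (stretch k (g j)) =
      (\<integral>\<^sup>+x. ennreal (indicator \<Omega> x * \<Psi> x) * \<Phi> (ennreal (stretch_dil CARD('n) (g' j (x $ k)))) \<partial>lborel)" for j
    using * by (intro Phi_integral_AE) auto
  have "Phi_integral \<Phi> \<Psi> \<Omega> (stretch k (\<lambda>t. c * t)) =
      (\<integral>\<^sup>+x. ennreal (indicator \<Omega> x * \<Psi> x) * \<Phi> q \<partial>lborel)"
    using * q by (intro Phi_integral_AE) auto
  also have "\<dots> = (\<integral>\<^sup>+x. ennreal (indicator \<Omega> x * \<Psi> x) \<partial>lborel) * \<Phi> q"
    using w by (intro nn_integral_multc) (auto simp: weight_def)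
  finally show "limsup (\<lambda>j. Phi_integral \<Phi> \<Psi> \<Omega> (stretch k (g j))) <
      Phi_integral \<Phi> \<Psi> \<Omega> (stretch k (\<lambda>t. c * t))"
    using int [OF w] unfolding fs by simp
qed

section \<open>Oscillating and linear sequences\<close>

text \<open>The limit map has the averaged slope, whereas the integrals tend to the average of the
  two values of \<Phi>; \<open>less\<close> compares exactly these.\<close>

lemma semicontinuity_fails_oscillating:
  fixes D :: "(real^'n) set" and \<Phi> :: "ennreal \<Rightarrow> ennreal"
  assumes n: "CARD('n) \<ge> 2" and D: "open D" and l: "0 \<le> l" "l \<le> 1" and a: "a > 0" and b: "b > 0"
    and fin: "\<Phi> (ennreal (stretch_dil CARD('n) a)) < top" "\<Phi> (ennreal (stretch_dil CARD('n) b)) < top"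
    and less: "ennreal l * \<Phi> (ennreal (stretch_dil CARD('n) a)) + ennreal (1 - l) * \<Phi> (ennreal (stretch_dil CARD('n) b)) <
      \<Phi> (ennreal (stretch_dil CARD('n) (l * a + (1 - l) * b)))"
  shows "semicontinuity_fails D \<Phi>"
proof -
  let ?c = "l * a + (1 - l) * b"
  \<comment> \<open>One exceptional set is chosen for each \<open>j\<close>, as only existence is
    known.\<close>
  define N where "N j = (SOME N. countable N \<and> (\<forall>t. t \<notin> N \<longrightarrow>
    (zigzag a b l j has_real_derivative (if frac (real (Suc j) * t) < l then a else b)) (at t)))" for j
  have N: "countable (N j) \<and> (\<forall>t. t \<notin> N j \<longrightarrow>
    (zigzag a b l j has_real_derivative (if frac (real (Suc j) * t) < l then a else b)) (at t))" for j
    unfolding N_def by (rule someI_ex) (metis zigzag_derivative)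
  have c: "?c > 0"
    using l a b by (cases "l = 0") (auto intro!: add_pos_nonneg)
  obtain k :: 'n where True by simp
  show ?thesis
  proof (rule semicontinuity_failsI [OF n D, where g = "zigzag a b l" and N = N and c = ?c and k = k
        and g' = "\<lambda>j t. if frac (real (Suc j) * t) < l then a else b"])
    show "\<exists>L. L-lipschitz_on UNIV (zigzag a b l j)" for j
      using zigzag_lipschitz [OF l a b] by blast
    show "uniform_limit (cball 0 r) (zigzag a b l) (\<lambda>t. ?c * t) sequentially" for r
    proof (rule uniform_limitI)
      fix e :: real
      assume "e > 0"
      moreover have "(\<lambda>j. \<bar>a - b\<bar> / real (Suc j)) \<longlonglongrightarrow> 0"
        by (rule LIMSEQ_Suc [OF lim_const_over_n])
      ultimately have "\<forall>\<^sub>F j in sequentially. \<bar>a - b\<bar> / real (Suc j) < e"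
        by (intro order_tendstoD)
      then show "\<forall>\<^sub>F j in sequentially. \<forall>t\<in>cball 0 r. dist (zigzag a b l j t) (?c * t) < e"
        by eventually_elim (auto simp: dist_real_def intro: le_less_trans [OF zigzag_close [OF l]])
    qed
    show "P_dil (stretch k (\<lambda>t. ?c * t)) x = ennreal (stretch_dil CARD('n) ?c)" for x
      by (rule P_dil_stretch [OF n c]) (auto intro!: derivative_eq_intros)
    fix w :: "real^'n \<Rightarrow> real"
    assume w: "weight w"
    let ?\<alpha> = "\<Phi> (ennreal (stretch_dil CARD('n) a))" and ?\<beta> = "\<Phi> (ennreal (stretch_dil CARD('n) b))"
    have "(\<lambda>j. \<integral>\<^sup>+x. w x * (if frac (real (Suc j) * x $ k) < l then ?\<alpha> else ?\<beta>) \<partial>lborel)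
      \<longlonglongrightarrow> (ennreal l * ?\<alpha> + ennreal (1 - l) * ?\<beta>) * (\<integral>\<^sup>+x. w x \<partial>lborel)"
      using w l fin unfolding weight_def by (intro oscillating_integral_tendsto) auto
    then have "limsup (\<lambda>j. \<integral>\<^sup>+x. w x * (if frac (real (Suc j) * x $ k) < l then ?\<alpha> else ?\<beta>) \<partial>lborel) =
        (ennreal l * ?\<alpha> + ennreal (1 - l) * ?\<beta>) * (\<integral>\<^sup>+x. w x \<partial>lborel)"
      by (intro lim_imp_Limsup) auto
    \<comment> \<open>Strictness survives because the mass of a weight is positive and
      finite.\<close>
    also have "\<dots> < \<Phi> (ennreal (stretch_dil CARD('n) ?c)) * (\<integral>\<^sup>+x. w x \<partial>lborel)"
      using w less by (intro ennreal_mult_strict_right_mono) (auto simp: weight_def)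
    finally show "limsup (\<lambda>j. \<integral>\<^sup>+x. w x * \<Phi> (ennreal (stretch_dil CARD('n)
        (if frac (real (Suc j) * x $ k) < l then a else b))) \<partial>lborel) <
      (\<integral>\<^sup>+x. w x \<partial>lborel) * \<Phi> (ennreal (stretch_dil CARD('n) ?c))"
      by (simp add: mult.commute if_distrib cong: if_cong)
  qed (use N a b inj_zigzag [OF l a b] in auto)
qed

text \<open>No oscillation is involved: \<open>M\<close> bounds \<Phi> along the sequence and lies
  below its value at the limit. The dilatation \<open>q\<close> is left general to admit the
  degenerate slope 0, where it is infinite.\<close>

lemma semicontinuity_fails_linear:
  fixes D :: "(real^'n) set" and \<Phi> :: "ennreal \<Rightarrow> ennreal"
  assumes n: "CARD('n) \<ge> 2" and D: "open D" and pos: "\<And>j. C j > 0" and lim: "C \<longlonglongrightarrow> c"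
    and q: "\<And>(k::'n) x. P_dil (stretch k (\<lambda>t. c * t)) x = q"
    and le: "\<And>j. \<Phi> (ennreal (stretch_dil CARD('n) (C j))) \<le> M" and less: "M < \<Phi> q"
  shows "semicontinuity_fails D \<Phi>"
proof -
  obtain k :: 'n where True by simp
  show ?thesis
  proof (rule semicontinuity_failsI [OF n D, where g = "\<lambda>j t. C j * t" and N = "\<lambda>_. {}" and c = c
        and k = k and g' = "\<lambda>j t. C j" and q = q])
    show "inj (\<lambda>t. C j * t)" for j
      using pos [of j] by (auto simp: inj_def)
    show "\<exists>L. L-lipschitz_on UNIV (\<lambda>t. C j * t)" for j
      using bounded_linear.lipschitz_boundE [OF bounded_linear_mult_right] by metis
    show "uniform_limit (cball 0 r) (\<lambda>j t. C j * t) (\<lambda>t. c * t) sequentially" for r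
    proof (rule uniform_limitI)
      fix e :: real
      assume "e > 0"
      then have "e / (\<bar>r\<bar> + 1) > 0"
        by (simp add: add_nonneg_pos)
      with lim have "\<forall>\<^sub>F j in sequentially. dist (C j) c < e / (\<bar>r\<bar> + 1)"
        by (rule tendstoD)
      then show "\<forall>\<^sub>F j in sequentially. \<forall>t\<in>cball 0 r. dist (C j * t) (c * t) < e"
      proof eventually_elim
        case (elim j)
        show ?case
        proof
          fix t :: real
          assume "t \<in> cball 0 r"
          then have "\<bar>C j - c\<bar> * \<bar>t\<bar> \<le> \<bar>C j - c\<bar> * (\<bar>r\<bar> + 1)"
            by (intro mult_left_mono) auto
          also have "\<dots> < e"
            using elim by (simp add: dist_real_def pos_less_divide_eq add_nonneg_pos)
          finally show "dist (C j * t) (c * t) < e"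
            by (simp add: dist_real_def flip: abs_mult left_diff_distrib)
        qed
      qed
    qed
    fix w :: "real^'n \<Rightarrow> real"
    assume w: "weight w"
    have "limsup (\<lambda>j. \<integral>\<^sup>+x. w x * \<Phi> (ennreal (stretch_dil CARD('n) (C j))) \<partial>lborel) \<le> (\<integral>\<^sup>+x. w x * M \<partial>lborel)"
      by (intro Limsup_bounded always_eventually allI nn_integral_mono mult_left_mono le) auto
    also have "\<dots> = (\<integral>\<^sup>+x. w x \<partial>lborel) * M"
      using w by (intro nn_integral_multc) (auto simp: weight_def)
    also have "\<dots> < (\<integral>\<^sup>+x. w x \<partial>lborel) * \<Phi> q"
      using w less by (intro ennreal_mult_strict_left_mono) (auto simp: weight_def)
    finally show "limsup (\<lambda>j. \<integral>\<^sup>+x. w x * \<Phi> (ennreal (stretch_dil CARD('n) (C j))) \<partial>lborel) <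
        (\<integral>\<^sup>+x. w x \<partial>lborel) * \<Phi> q" .
  qed (use pos q in \<open>auto intro!: derivative_eq_intros\<close>)
qed

section \<open>The three kinds of failure\<close>

lemma semicontinuity_fails_if_not_nondecreasing:
  fixes D :: "(real^'n) set" and \<Phi> :: "ennreal \<Rightarrow> ennreal"
  assumes n: "CARD('n) \<ge> 2" and D: "open D" and top: "\<Phi> top = top" and "\<not> Phi_nondecreasing \<Phi>"
  shows "semicontinuity_fails D \<Phi>"
proof -
  obtain s' t' where st': "1 \<le> s'" "s' \<le> t'" "\<Phi> t' < \<Phi> s'"
    using assms(4) by (auto simp: Phi_nondecreasing_def not_le)
  \<comment> \<open>\<open>\<Phi> top\<close> is the largest possible value, so a strict decrease of
    \<Phi> cannot end at \<open>top\<close>.\<close>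
  then have "t' \<noteq> top" "s' \<noteq> top"
    using top by (auto simp: top_unique)
  moreover have "s' < t'"
    using st' by (auto simp: order_le_less)
  ultimately obtain s t where st: "s' = ennreal s" "t' = ennreal t" "1 \<le> s" "s < t"
    using st'(1) by (cases s'; cases t') (auto simp: ennreal_less_iff)
  \<comment> \<open>The compressing slope whose dilatation is also \<open>t\<close>.\<close>
  define b where "b = 1 / t ^ (CARD('n) - 1)"
  have "t ^ (CARD('n) - 1) > 1"
    using n st by (intro one_less_power) auto
  then have b: "0 < b" "b < 1"
    by (auto simp: b_def)
  have dil: "stretch_dil CARD('n) b = t" "stretch_dil CARD('n) t = t" "stretch_dil CARD('n) s = s"
    using stretch_dil_inverse_power [OF n, of t] st by (auto simp: b_def stretch_dil_def)
  \<comment> \<open>The solution of \<open>l * t + (1 - l) * b = s\<close>; it lies in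
    \<open>[0, 1]\<close> because \<open>b < 1 \<le> s < t\<close>.\<close>
  define l where "l = (s - b) / (t - b)"
  have l: "0 \<le> l" "l \<le> 1"
    using st b by (auto simp: l_def)
  have "l * (t - b) = s - b"
    using st b by (simp add: l_def)
  then have s: "l * t + (1 - l) * b = s"
    by (simp add: algebra_simps)
  have "ennreal l * \<Phi> t' + ennreal (1 - l) * \<Phi> t' = \<Phi> t'"
    using l by (simp flip: distrib_right ennreal_plus)
  moreover have "\<Phi> t' < top"
    using st'(3) top_greatest by (rule less_le_trans)
  ultimately show ?thesis
    using st' st b l
    by (intro semicontinuity_fails_oscillating [OF n D l, of t b]) (auto simp: dil s)
qed

text \<open>The slopes \<open>s\<close>, \<open>t\<close> and their average are at least 1, where
  slope and dilatation coincide, so the failed convexity inequality is exactly what oscillation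
  requires.\<close>

lemma semicontinuity_fails_if_not_convex:
  fixes D :: "(real^'n) set" and \<Phi> :: "ennreal \<Rightarrow> ennreal"
  assumes n: "CARD('n) \<ge> 2" and D: "open D" and "\<not> Phi_convex \<Phi>"
  shows "semicontinuity_fails D \<Phi>"
proof -
  obtain s t l :: real where st: "1 \<le> s" "1 \<le> t" and l: "0 \<le> l" "l \<le> 1" and
    less: "ennreal l * \<Phi> (ennreal s) + ennreal (1 - l) * \<Phi> (ennreal t) < \<Phi> (ennreal (l * s + (1 - l) * t))"
    using assms(3) by (auto simp: Phi_convex_def not_le)
  \<comment> \<open>At the endpoints both sides agree. With both coefficients positive, a finite
    average forces both values to be finite.\<close>
  have l': "0 < l" "l < 1"
    using l less by (auto simp: order_le_less)
  have "ennreal l * \<Phi> (ennreal s) + ennreal (1 - l) * \<Phi> (ennreal t) < top"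
    using less less_le_trans top_greatest by blast
  then have fin: "\<Phi> (ennreal s) < top" "\<Phi> (ennreal t) < top"
    using l' by (auto simp: ennreal_mult_less_top)
  have "l * 1 + (1 - l) * 1 \<le> l * s + (1 - l) * t"
    using st l by (intro add_mono mult_left_mono) auto
  then have "stretch_dil CARD('n) s = s" "stretch_dil CARD('n) t = t"
     "stretch_dil CARD('n) (l * s + (1 - l) * t) = l * s + (1 - l) * t"
    using st by (auto simp: stretch_dil_def)
  then show ?thesis
    using st l fin less by (intro semicontinuity_fails_oscillating [OF n D l, of s t]) auto
qed

text \<open>By monotonicity the left limit at \<open>T\<close> is the supremum \<open>M\<close>, so
  a discontinuity means \<open>M < \<Phi> T\<close>. Linear maps with dilatation below
  \<open>T\<close> can then approach one with dilatation \<open>T\<close>.\<close>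

lemma semicontinuity_fails_if_not_left_continuous:
  fixes D :: "(real^'n) set" and \<Phi> :: "ennreal \<Rightarrow> ennreal"
  assumes n: "CARD('n) \<ge> 2" and D: "open D" and nonconst: "\<exists>s t. 1 \<le> s \<and> 1 \<le> t \<and> \<Phi> s \<noteq> \<Phi> t"
    and mono: "Phi_nondecreasing \<Phi>" and disc: "\<not> Phi_left_cont_at_T \<Phi>"
  shows "semicontinuity_fails D \<Phi>"
proof -
  define T where "T = Phi_T \<Phi>"
  define M where "M = (SUP t\<in>{1..<T}. \<Phi> t)"
  have M: "\<Phi> t \<le> M" if "1 \<le> t" "t < T" for t
    unfolding M_def using that by (intro SUP_upper) auto
  \<comment> \<open>A nonconstant \<Phi> is finite somewhere, so the supremum defining
    \<open>T\<close> is over a nonempty set.\<close>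
  have "T \<ge> 1"
  proof -
    obtain s where "1 \<le> s" "\<Phi> s < top"
      using nonconst by (metis top.not_eq_extremum)
    then show ?thesis
      unfolding T_def Phi_T_def by (auto intro: Sup_upper2)
  qed
  \<comment> \<open>For \<open>T = 1\<close> the interval below \<open>T\<close> is empty and left
    continuity holds vacuously.\<close>
  have "T \<noteq> 1"
    using disc by (auto simp: Phi_left_cont_at_T_def T_def)
  with \<open>T \<ge> 1\<close> have T: "1 < T"
    by simp
  have less: "M < \<Phi> T"
  proof (rule ccontr)
    assume "\<not> M < \<Phi> T"
    then have "\<Phi> T \<le> M"
      by simp
    have "(\<Phi> \<longlongrightarrow> \<Phi> T) (at T within {1..<T})"
    proof (rule order_tendstoI)
      fix a
      assume "a < \<Phi> T"
      then obtain t where t: "1 \<le> t" "t < T" "a < \<Phi> t"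
        using \<open>\<Phi> T \<le> M\<close> less_le_trans unfolding M_def less_SUP_iff by (metis atLeastLessThan_iff less_SUP_iff)
      have "a < \<Phi> u" if "t < u" "u < T" for u
        using t that mono less_le_trans unfolding Phi_nondecreasing_def by (metis less_imp_le)
      then show "\<forall>\<^sub>F u in at T within {1..<T}. a < \<Phi> u"
        unfolding eventually_at_topological using t(2) by (intro exI [of _ "{t<..}"]) auto
    next
      fix a
      assume a: "\<Phi> T < a"
      have "\<Phi> u < a" if "1 \<le> u" "u < T" for u
        using a that mono le_less_trans unfolding Phi_nondecreasing_def by (metis less_imp_le)
      then show "\<forall>\<^sub>F u in at T within {1..<T}. \<Phi> u < a"
        unfolding eventually_at_topological by (intro exI [of _ UNIV]) auto
    qed
    with disc show False
      by (simp add: Phi_left_cont_at_T_def T_def)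
  qed
  show ?thesis
  proof (cases "T = top")
    case True
    \<comment> \<open>Compressions with slopes tending to 0 have finite dilatation, below
      \<open>T = top\<close>, while the collapsed limit has dilatation \<open>top\<close>.\<close>
    show ?thesis
    proof (rule semicontinuity_fails_linear [OF n D, of "\<lambda>j. inverse (real (Suc j))" 0])
      show "P_dil (stretch k (\<lambda>t. 0 * t)) x = T" for k :: 'n and x
        unfolding True by (rule P_dil_stretch_0 [OF n]) simp
      show "\<Phi> (ennreal (stretch_dil CARD('n) (inverse (real (Suc j))))) \<le> M" for j
        using stretch_dil_ge_1 [OF n, of "inverse (real (Suc j))"] True by (intro M) auto
    qed (use less LIMSEQ_inverse_real_of_nat in auto)
  next
    case False
    then obtain u where u: "T = ennreal u" "1 < u"
      using T by (cases T) auto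
    \<comment> \<open>The slopes start at 1 for \<open>j = 0\<close> and tend to \<open>u\<close>
      from below, so each equals its own dilatation.\<close>
    let ?C = "\<lambda>j. u - (u - 1) / real (Suc j)"
    have C: "1 \<le> ?C j" "?C j < u" for j
    proof -
      have "(u - 1) / real (Suc j) \<le> (u - 1) / 1"
        using u by (intro divide_left_mono) auto
      then show "1 \<le> ?C j"
        by simp
    qed (use u in auto)
    then have dil: "stretch_dil CARD('n) (?C j) = ?C j" for j
      unfolding stretch_dil_def by meson
    show ?thesis
    proof (rule semicontinuity_fails_linear [OF n D, of ?C u])
      show "P_dil (stretch k (\<lambda>t. u * t)) x = T" for k :: 'n and x
        using P_dil_stretch [OF n, of u "\<lambda>t. u * t" x k] u by (auto simp: stretch_dil_def intro!: derivative_eq_intros)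
      show "\<Phi> (ennreal (stretch_dil CARD('n) (?C j))) \<le> M" for j
        unfolding dil using C [of j] u by (intro M) (auto intro!: ennreal_lessI)
      show "?C j > 0" for j
        using C(1) [of j] by linarith
      have "(\<lambda>j. (u - 1) / real (Suc j)) \<longlonglongrightarrow> 0"
        by (rule LIMSEQ_Suc [OF lim_const_over_n])
      then show "?C \<longlonglongrightarrow> u"
        using tendsto_diff [OF tendsto_const [of u]] by fastforce
    qed (rule less)
  qed
qed

theorem theorem8p1:
  fixes D :: "(real^'n) set" and \<Phi> :: "ennreal \<Rightarrow> ennreal"
  assumes "CARD('n) \<ge> 2"
    and "open D" and "connected D" and "D \<noteq> {}"
    and "\<exists>s t. 1 \<le> s \<and> 1 \<le> t \<and> \<Phi> s \<noteq> \<Phi> t"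
    and "\<Phi> top = top"
    and "\<not> Phi_convex \<Phi> \<or> \<not> Phi_nondecreasing \<Phi> \<or> \<not> Phi_left_cont_at_T \<Phi>"
  shows "\<exists>(fs :: nat \<Rightarrow> real^'n \<Rightarrow> real^'n) (f :: real^'n \<Rightarrow> real^'n).
           (\<forall>j. (\<exists>g. homeomorphism D (fs j ` D) (fs j) g) \<and> W11_loc D (fs j)) \<and>
           (\<forall>K. compact K \<and> K \<subseteq> D \<longrightarrow> uniform_limit K fs f sequentially) \<and>
           (AE x in lebesgue. x \<in> D \<longrightarrow> f differentiable (at x)) \<and>
           (\<forall>\<Omega> (\<Psi> :: real^'n \<Rightarrow> real).
              open \<Omega> \<and> bounded \<Omega> \<and> \<Omega> \<noteq> {} \<and> \<Omega> \<subseteq> D \<and> continuous_on UNIV \<Psi> \<and> (\<forall>x. 0 < \<Psi> x) \<longrightarrow>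
              Phi_integral \<Phi> \<Psi> \<Omega> f > limsup (\<lambda>j. Phi_integral \<Phi> \<Psi> \<Omega> (fs j)))"
  unfolding semicontinuity_fails_def [symmetric]
  \<comment> \<open>Failure of left continuity is needed only for nondecreasing \<Phi>, the other
    case being settled first.\<close>
  using semicontinuity_fails_if_not_nondecreasing [of D \<Phi>]
    semicontinuity_fails_if_not_convex [of D \<Phi>]
    semicontinuity_fails_if_not_left_continuous [of D \<Phi>] assms by blast

end
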